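(* For every $X\in\{P\omega\}\cup\{k^\omega_\bot\mid 2\leq k\leq\omega\}$, $FO(\mathbf{\Sigma}^0_1(X))\equiv_m FO(\mathbb{N}_2)$.
   Context: $P\omega$ is the powerset of $\omega$ with the (Scott) topology generated by the sets $\uparrow F=\{A\mid F\subseteq A\subseteq\omega\}$ for finite $F\subseteq\omega$. For $2\leq k\leq\omega$, $k^\omega_\bot$ is the space of partial functions $g:\omega\rightharpoonup\{0,\dots,k-1\}$ (for $k=\omega$: partial functions $\omega\rightharpoonup\omega$) with the topology generated by the sets $\{g\mid f\subseteq g\}$ where $f$ ranges over partial functions with finite graph and $\subseteq$ is inclusion of graphs. $\mathbf{\Sigma}^0_1(X)$ denotes the lattice of all open subsets of $X$ (signature $\{\subseteq\}$), $FO(\mathbb{A})$ the set of first-order sentences true in $\mathbb{A}$, $\equiv_m$ many-one equivalence, and $\mathbb{N}_2=(\omega\cup P(\omega);\omega,P(\omega),\in,+,\times)$ second-order arithmetic. *)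

theory Defs
  imports "HOL-Analysis.Analysis" "HOL-Library.Nat_Bijection" "HOL-Library.Extended_Nat"
begin

datatype recf = Zf | Sf | Proj nat | Comp recf "recf list" | Prim recf recf | Mn recf

inductive reval :: "recf \<Rightarrow> nat list \<Rightarrow> nat \<Rightarrow> bool" where
  r_zero: "reval Zf xs 0"
| r_suc: "reval Sf (x # xs) (Suc x)"
| r_proj: "i < length xs \<Longrightarrow> reval (Proj i) xs (xs ! i)"
| r_comp: "list_all2 (\<lambda>g y. reval g xs y) gs ys \<Longrightarrow> reval f ys z \<Longrightarrow> reval (Comp f gs) xs z"
| r_prim0: "reval f xs y \<Longrightarrow> reval (Prim f g) (0 # xs) y"
| r_primS: "reval (Prim f g) (n # xs) y \<Longrightarrow> reval g (n # y # xs) z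
             \<Longrightarrow> reval (Prim f g) (Suc n # xs) z"
| r_mn: "reval f (n # xs) 0 \<Longrightarrow> (\<forall>m<n. \<exists>y. 0 < y \<and> reval f (m # xs) y)
             \<Longrightarrow> reval (Mn f) xs n"

definition computable :: "(nat \<Rightarrow> nat) \<Rightarrow> bool" where
  "computable f \<longleftrightarrow> (\<exists>p. \<forall>n. reval p [n] (f n))"

definition many_one_reducible :: "nat set \<Rightarrow> nat set \<Rightarrow> bool" where
  "many_one_reducible A B \<longleftrightarrow> (\<exists>f. computable f \<and> (\<forall>n. n \<in> A \<longleftrightarrow> f n \<in> B))"

definition many_one_equiv :: "nat set \<Rightarrow> nat set \<Rightarrow> bool" (infix "\<equiv>\<^sub>m" 50) where
  "A \<equiv>\<^sub>m B \<longleftrightarrow> many_one_reducible A B \<and> many_one_reducible B A"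

datatype fm = Rel nat "nat list" | Eq nat nat | Neg fm | Conj fm fm | Ex nat fm

fun freevars :: "fm \<Rightarrow> nat set" where
  "freevars (Rel r xs) = set xs"
| "freevars (Eq x y) = {x, y}"
| "freevars (Neg p) = freevars p"
| "freevars (Conj p q) = freevars p \<union> freevars q"
| "freevars (Ex x p) = freevars p - {x}"

fun wf_fm :: "(nat \<Rightarrow> nat option) \<Rightarrow> fm \<Rightarrow> bool" where
  "wf_fm sig (Rel r xs) = (sig r = Some (length xs))"
| "wf_fm sig (Eq x y) = True"
| "wf_fm sig (Neg p) = wf_fm sig p"
| "wf_fm sig (Conj p q) = (wf_fm sig p \<and> wf_fm sig q)"
| "wf_fm sig (Ex x p) = wf_fm sig p"

fun sat :: "'a set \<Rightarrow> (nat \<Rightarrow> 'a list \<Rightarrow> bool) \<Rightarrow> (nat \<Rightarrow> 'a) \<Rightarrow> fm \<Rightarrow> bool" where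
  "sat D I e (Rel r xs) = I r (map e xs)"
| "sat D I e (Eq x y) = (e x = e y)"
| "sat D I e (Neg p) = (\<not> sat D I e p)"
| "sat D I e (Conj p q) = (sat D I e p \<and> sat D I e q)"
| "sat D I e (Ex x p) = (\<exists>a\<in>D. sat D I (e(x := a)) p)"

fun code :: "fm \<Rightarrow> nat" where
  "code (Rel r xs) = prod_encode (0, prod_encode (r, list_encode xs))"
| "code (Eq x y) = prod_encode (1, prod_encode (x, y))"
| "code (Neg p) = prod_encode (2, code p)"
| "code (Conj p q) = prod_encode (3, prod_encode (code p, code q))"
| "code (Ex x p) = prod_encode (4, prod_encode (x, code p))"

definition FO :: "(nat \<Rightarrow> nat option) \<Rightarrow> 'a set \<Rightarrow> (nat \<Rightarrow> 'a list \<Rightarrow> bool) \<Rightarrow> nat set" where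
  "FO sig D I = {code \<phi> | \<phi>. wf_fm sig \<phi> \<and> freevars \<phi> = {} \<and>
                   (\<forall>e. (\<forall>v. e v \<in> D) \<longrightarrow> sat D I e \<phi>)}"

definition sig_subset :: "nat \<Rightarrow> nat option" where
  "sig_subset = [0 \<mapsto> 2]"

definition FO_opens :: "'a topology \<Rightarrow> nat set" where
  "FO_opens T = FO sig_subset {U. openin T U}
      (\<lambda>r xs. r = 0 \<and> length xs = 2 \<and> xs ! 0 \<subseteq> xs ! 1)"

definition sig_N2 :: "nat \<Rightarrow> nat option" where
  "sig_N2 = [0 \<mapsto> 1, 1 \<mapsto> 1, 2 \<mapsto> 2, 3 \<mapsto> 3, 4 \<mapsto> 3]"

fun N2_rel :: "nat \<Rightarrow> (nat + nat set) list \<Rightarrow> bool" where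
  "N2_rel 0 [x] = isl x"
| "N2_rel (Suc 0) [x] = (\<not> isl x)"
| "N2_rel (Suc (Suc 0)) [x, y] = (\<exists>n A. x = Inl n \<and> y = Inr A \<and> n \<in> A)"
| "N2_rel (Suc (Suc (Suc 0))) [x, y, z] = (\<exists>a b. x = Inl a \<and> y = Inl b \<and> z = Inl (a + b))"
| "N2_rel (Suc (Suc (Suc (Suc 0)))) [x, y, z] = (\<exists>a b. x = Inl a \<and> y = Inl b \<and> z = Inl (a * b))"
| "N2_rel _ _ = False"

definition FO_N2 :: "nat set" where
  "FO_N2 = FO sig_N2 (UNIV :: (nat + nat set) set) N2_rel"

text \<open>Scott topology on P(omega).\<close>
definition Pomega :: "nat set topology" where
  "Pomega = topology_generated_by {{A. F \<subseteq> A} | F. finite F}"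

text \<open>k^omega_bot for 2 <= k <= omega (k :: enat, infinity = omega): partial functions
  omega -> {0..k-1}, topology generated by {g | f subset-map g}, f finite partial.\<close>
definition pfun_space :: "enat \<Rightarrow> (nat \<Rightarrow> nat option) set" where
  "pfun_space k = {g. \<forall>n v. g n = Some v \<longrightarrow> enat v < k}"

definition kPartial :: "enat \<Rightarrow> (nat \<Rightarrow> nat option) topology" where
  "kPartial k = topology_generated_by
     {{g \<in> pfun_space k. f \<subseteq>\<^sub>m g} | f. finite (dom f) \<and> f \<in> pfun_space k}"

end

theory Submission
  imports Defs
begin

text \<open>In each of these spaces an open set is determined by the finite elements it contains, so the
  lattice of open sets is the lattice of upsets of a poset of finite sets: all finite subsets of
  \<open>\<omega>\<close>, or the finite graphs of partial functions.

  An upset is generated by some set of codes of finite sets, and inclusion of generated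
  upsets is arithmetical in these sets of codes, which gives the reduction to second-order arithmetic.

  Conversely, the principal upsets are the completely join-irreducible elements of the lattice. Take three
  families \<open>x\<close>, \<open>y\<close>, \<open>z\<close> of atoms with all finite unions present. The principal upsets of
  the \<open>{x n}\<close> serve as numbers, and an arbitrary open set \<open>U\<close> codes the set of numbers below it.
  The upset generated by the antichain of all \<open>{x a, y b, z c}\<close> with \<open>c = a + b\<close> codes
  addition, likewise for multiplication, and the pairs \<open>{x n, y n}\<close>, \<open>{x n, z n}\<close> generate an
  upset that matches the families. A sentence of second-order arithmetic is true iff its translation holds
  for some choice of these open sets satisfying the second-order Peano axioms.\<close>

section \<open>Recursive functions\<close>

text \<open>Inclusion is the only primitive, so meets, numbers and ternary relations all have to be
  recognised from the order. A finite set keeps neither the order nor the multiplicity of its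
  elements: with a single family, \<open>{x a, x b, x c}\<close> would not tell the summands from
  the sum, and it would shrink when arguments coincide, so that one generator could lie inside
  another. Sets with exactly one atom from each of three families are pairwise incomparable, but
  then numbers exist in three copies, and this is why a matching is among the parameters. No formula
  can single out particular atoms, because permutations of \<omega> act on each lattice. The
  parameters are therefore quantified, and a wrong choice is excluded by categoricity: as open sets
  cut out every set of numbers, the induction axiom has its full second-order strength, and all
  admissible choices interpret the same structure. A closed sentence thus has the same value for all
  of them. A many-one reduction must also act on numbers that code no sentence, hence the care with
  ill-formed and open formulas.\<close>

definition recursive :: "nat \<Rightarrow> (nat list \<Rightarrow> nat) \<Rightarrow> bool" where
  "recursive k f \<longleftrightarrow> (\<exists>p. \<forall>xs. length xs = k \<longrightarrow> reval p xs (f xs))"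

abbreviation "recursive1 F \<equiv> recursive 1 (\<lambda>xs. F (xs ! 0))"
abbreviation "recursive2 F \<equiv> recursive 2 (\<lambda>xs. F (xs ! 0) (xs ! 1))"
abbreviation "recursive3 F \<equiv> recursive 3 (\<lambda>xs. F (xs ! 0) (xs ! 1) (xs ! 2))"

named_theorems rec_intros

lemma recursive_cong:
  "recursive k f \<Longrightarrow> (\<And>xs. length xs = k \<Longrightarrow> f xs = g xs) \<Longrightarrow> recursive k g"
  unfolding recursive_def by metis

lemma recursive_proj [rec_intros]: "i < k \<Longrightarrow> recursive k (\<lambda>xs. xs ! i)"
  unfolding recursive_def by (metis r_proj)

lemma recursive_comp:
  assumes "recursive (length fs) h" "\<forall>f\<in>set fs. recursive k f"
  shows "recursive k (\<lambda>xs. h (map (\<lambda>f. f xs) fs))"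
proof -
  from assms(1) obtain p where p: "\<And>xs. length xs = length fs \<Longrightarrow> reval p xs (h xs)"
    unfolding recursive_def by blast
  from assms(2) obtain q where q: "\<And>f xs. f \<in> set fs \<Longrightarrow> length xs = k \<Longrightarrow> reval (q f) xs (f xs)"
    unfolding recursive_def by metis
  have "reval (Comp p (map q fs)) xs (h (map (\<lambda>f. f xs) fs))" if "length xs = k" for xs
    using q p that by (intro r_comp[where ys = "map (\<lambda>f. f xs) fs"])
      (auto simp: list_all2_conv_all_nth)
  then show ?thesis unfolding recursive_def by blast
qed

lemma recursive1_app:
  assumes "recursive1 F" "recursive k f"
  shows "recursive k (\<lambda>xs. F (f xs))"
  using recursive_comp[of "[f]" "\<lambda>xs. F (xs ! 0)" k] assms by simp

lemma recursive2_app: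
  assumes "recursive2 F" "recursive k f" "recursive k g"
  shows "recursive k (\<lambda>xs. F (f xs) (g xs))"
  using recursive_comp[of "[f, g]" "\<lambda>xs. F (xs ! 0) (xs ! 1)" k] assms
  by (simp add: numeral_2_eq_2)

lemma recursive3_app:
  assumes "recursive3 F" "recursive k f" "recursive k g" "recursive k h"
  shows "recursive k (\<lambda>xs. F (f xs) (g xs) (h xs))"
  using recursive_comp[of "[f, g, h]" "\<lambda>xs. F (xs ! 0) (xs ! 1) (xs ! 2)" k] assms
  by (simp add: numeral_2_eq_2 numeral_3_eq_3)

lemma recursive_Suc [rec_intros]: "recursive k f \<Longrightarrow> recursive k (\<lambda>xs. Suc (f xs))"
proof (rule recursive1_app[of Suc])
  have "reval Sf xs (Suc (xs ! 0))" if "length xs = 1" for xs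
    using that r_suc by (cases xs) auto
  then show "recursive1 Suc" unfolding recursive_def by blast
qed

lemma recursive_const [rec_intros]: "recursive k (\<lambda>xs. c)"
proof (induction c)
  case 0
  show ?case unfolding recursive_def using r_zero by blast
qed (rule recursive_Suc)

lemma recursive_prim:
  assumes "recursive k b" "recursive (Suc (Suc k)) s"
  shows "recursive (Suc k) (\<lambda>xs. rec_nat (b (tl xs)) (\<lambda>n y. s (n # y # tl xs)) (hd xs))"
proof -
  from assms obtain p q where p: "\<And>xs. length xs = k \<Longrightarrow> reval p xs (b xs)"
    and q: "\<And>xs. length xs = Suc (Suc k) \<Longrightarrow> reval q xs (s xs)"
    unfolding recursive_def by blast
  have *: "reval (Prim p q) (n # xs) (rec_nat (b xs) (\<lambda>n y. s (n # y # xs)) n)"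
    if "length xs = k" for n xs
    using that by (induction n) (auto intro!: r_prim0 p r_primS q)
  have "reval (Prim p q) xs (rec_nat (b (tl xs)) (\<lambda>n y. s (n # y # tl xs)) (hd xs))"
    if "length xs = Suc k" for xs
    using that * by (cases xs) auto
  then show ?thesis unfolding recursive_def by blast
qed

lemma recursive1_prim:
  assumes "recursive2 s"
  shows "recursive1 (rec_nat c s)"
  using recursive_prim[of 0 "\<lambda>_. c" "\<lambda>xs. s (xs ! 0) (xs ! 1)"] assms
  by (auto simp: numeral_2_eq_2 recursive_const length_Suc_conv elim!: recursive_cong)

lemma recursive2_prim:
  assumes "recursive1 b" "recursive3 s"
  shows "recursive2 (\<lambda>n x. rec_nat (b x) (\<lambda>n y. s n y x) n)"
  using recursive_prim[of 1 "\<lambda>xs. b (xs ! 0)" "\<lambda>xs. s (xs ! 0) (xs ! 1) (xs ! 2)"] assms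
  by (auto simp: numeral_2_eq_2 numeral_3_eq_3 length_Suc_conv elim!: recursive_cong)

lemma recursive_add [rec_intros]:
  assumes "recursive k f" "recursive k g"
  shows "recursive k (\<lambda>xs. f xs + g xs)"
proof (rule recursive2_app[OF _ assms])
  have "rec_nat x (\<lambda>_. Suc) n = n + x" for n x by (induction n) auto
  then show "recursive2 (+)"
    using recursive2_prim[of "\<lambda>x. x" "\<lambda>n y x. Suc y"] by (simp add: rec_intros)
qed

lemma recursive_mult [rec_intros]:
  assumes "recursive k f" "recursive k g"
  shows "recursive k (\<lambda>xs. f xs * g xs)"
proof (rule recursive2_app[OF _ assms])
  have "rec_nat 0 (\<lambda>_ y. y + x) n = n * x" for n x by (induction n) auto
  then show "recursive2 (*)"
    using recursive2_prim[of "\<lambda>x. 0" "\<lambda>n y x. y + x"] by (simp add: rec_intros)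
qed

lemma recursive_diff [rec_intros]:
  assumes "recursive k f" "recursive k g"
  shows "recursive k (\<lambda>xs. f xs - g xs)"
\<comment> \<open>Recursion runs over the first argument, so the subtrahend is put in front.\<close>
proof (rule recursive2_app[of "\<lambda>n x. x - n", OF _ assms(2,1)])
  have "rec_nat 0 (\<lambda>n _. n) n = n - 1" for n by (induction n) auto
  then have pred: "recursive1 (\<lambda>n. n - 1)"
    using recursive1_prim[of "\<lambda>n y. n" 0] by (simp add: rec_intros)
  have "rec_nat x (\<lambda>_ y. y - 1) n = x - n" for n x by (induction n) auto
  then show "recursive2 (\<lambda>n x. x - n)"
    using recursive2_prim[of "\<lambda>x. x" "\<lambda>n y x. y - 1"] recursive1_app[OF pred]
    by (simp add: rec_intros)
qed

lemma recursive_if_eq [rec_intros]: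
  assumes "recursive k f" "recursive k g" "recursive k a" "recursive k b"
  shows "recursive k (\<lambda>xs. if f xs = g xs then a xs else b xs)"
proof -
  \<comment> \<open>With truncated subtraction \<open>?z\<close> is the distance of the two values,
    and \<open>1 - ?z\<close> is 1 exactly when they agree.\<close>
  let ?z = "\<lambda>xs. (f xs - g xs) + (g xs - f xs)"
  have "recursive k (\<lambda>xs. a xs * (1 - ?z xs) + b xs * (1 - (1 - ?z xs)))"
    by (intro rec_intros assms)
  then show ?thesis by (rule recursive_cong) auto
qed

lemma recursive_if_less [rec_intros]:
  assumes "recursive k f" "recursive k g" "recursive k a" "recursive k b"
  shows "recursive k (\<lambda>xs. if f xs < g xs then a xs else b xs)"
proof -
  have "recursive k (\<lambda>xs. if Suc (f xs) - g xs = 0 then a xs else b xs)"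
    by (intro rec_intros assms)
  then show ?thesis by (rule recursive_cong) auto
qed

text \<open>The induction peels off one table entry at a time. This covers the arities of a finite
  signature and the codes of the finitely many interpreting formulas, whatever these are.\<close>

lemma recursive1_eventually_const:
  assumes "\<And>r. N \<le> r \<Longrightarrow> f r = c"
  shows "recursive1 f"
  using assms
proof (induction N arbitrary: f)
  case 0
  then show ?case by (simp add: rec_intros)
next
  case (Suc N)
  have "recursive1 (f(N := c))" using Suc.prems by (intro Suc.IH) auto
  then have "recursive1 (\<lambda>r. if r = N then f N else (f(N := c)) r)"
    by (intro rec_intros) auto
  then show ?case by (rule recursive_cong) auto
qed

lemma recursive_triangle [rec_intros]:
  assumes "recursive k f" shows "recursive k (\<lambda>xs. triangle (f xs))"
proof (rule recursive1_app[OF _ assms])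
  have "rec_nat 0 (\<lambda>n y. y + Suc n) n = triangle n" for n by (induction n) auto
  then show "recursive1 triangle"
    using recursive1_prim[of "\<lambda>n y. y + Suc n" 0] by (simp add: rec_intros)
qed

section \<open>Pairing, its inverse, and course-of-values recursion\<close>

lemma recursive_prod_encode [rec_intros]:
  assumes "recursive k f" "recursive k g"
  shows "recursive k (\<lambda>xs. prod_encode (f xs, g xs))"
  using assms by (simp add: prod_encode_def rec_intros)

lemma triangle_mono: "m \<le> n \<Longrightarrow> triangle m \<le> triangle n"
  by (induction n) (auto simp: le_Suc_eq)

abbreviation "pfst n \<equiv> fst (prod_decode n)"
abbreviation "psnd n \<equiv> snd (prod_decode n)"

lemma recursive_prod_decode:
  shows "recursive1 pfst" and "recursive1 psnd"
proof -
  \<comment> \<open>\<open>d n\<close> is the largest \<open>d\<close> with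
    \<open>triangle d \<le> n\<close>, the diagonal on which \<open>n\<close> lies. It grows by at
    most one from \<open>n\<close> to \<open>Suc n\<close>, so primitive recursion finds it without
    a search; both components follow from it, because \<open>prod_encode (a, b)\<close> is
    \<open>triangle (a + b) + a\<close>.\<close>
  define d where "d = rec_nat 0 (\<lambda>n y. if triangle (Suc y) < Suc (Suc n) then Suc y else y)"
  have d: "recursive1 d"
    unfolding d_def by (intro recursive1_prim rec_intros) auto
  have bounds: "triangle (d n) \<le> n \<and> n < triangle (Suc (d n))" for n
    by (induction n) (auto simp: d_def)
  have deq: "d (prod_encode (a, b)) = a + b" for a b
  proof (rule ccontr)
    define n where "n = prod_encode (a, b)"
    have n: "n = triangle (a + b) + a" by (simp add: n_def prod_encode_def)
    assume "\<not> ?thesis"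
    then consider "Suc (d n) \<le> a + b" | "Suc (a + b) \<le> d n" by (fold n_def) linarith
    then show False
    proof cases
      case 1
      then show ?thesis using bounds[of n] triangle_mono[OF 1] n by linarith
    next
      case 2
      then show ?thesis using bounds[of n] triangle_mono[OF 2] n by simp
    qed
  qed
  have dec: "pfst n = n - triangle (d n)" "psnd n = d n - (n - triangle (d n))" for n
  proof -
    obtain a b where ab: "prod_decode n = (a, b)" by fastforce
    then have n: "n = prod_encode (a, b)" by (metis prod_decode_inverse)
    show "pfst n = n - triangle (d n)" "psnd n = d n - (n - triangle (d n))"
      using deq[of a b] ab unfolding n by (auto simp: prod_encode_def)
  qed
  show "recursive1 pfst" "recursive1 psnd" unfolding dec
    by (intro rec_intros recursive1_app[of d, OF d]; simp)+
qed

lemmas recursive_pfst [rec_intros] = recursive1_app[of pfst, OF recursive_prod_decode(1)]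
lemmas recursive_psnd [rec_intros] = recursive1_app[of psnd, OF recursive_prod_decode(2)]

text \<open>The history of \<open>F\<close> up to \<open>n\<close> is kept as the nested pair
  \<open>(F (n-1), (F (n-2), \<dots>))\<close>, so that earlier values are found by iterating the second projection.\<close>

lemma recursive_course_of_values:
  fixes F :: "nat \<Rightarrow> nat"
  assumes G: "recursive3 G" and a: "recursive1 a" and b: "recursive1 b"
    and F: "\<And>n. F n = G n (if a n < n then F (a n) else 0) (if b n < n then F (b n) else 0)"
  shows "recursive1 F"
proof -
  define drop where "drop d c = rec_nat c (\<lambda>_ y. psnd y) d" for d c :: nat
  define look where "look n h j = pfst (drop (n - Suc j) h)" for n h j :: nat
  define step where "step n h = prod_encode
    (G n (if a n < n then look n h (a n) else 0) (if b n < n then look n h (b n) else 0), h)" for n h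
  define hist where "hist = rec_nat 0 (\<lambda>n h. prod_encode (F n, h))"
  have hist_Suc: "hist (Suc n) = prod_encode (F n, hist n)" for n by (simp add: hist_def)
  have drop: "drop d (hist (j + d)) = hist j" for d j
  proof (induction d arbitrary: j)
    case (Suc d)
    have "drop (Suc d) (hist (j + Suc d)) = psnd (drop d (hist (Suc j + d)))"
      by (simp add: drop_def)
    also have "\<dots> = psnd (hist (Suc j))" by (simp only: Suc)
    finally show ?case by (simp add: hist_Suc)
  qed (simp add: drop_def)
  have look: "look n (hist n) j = F j" if "j < n" for n j
  proof -
    have "Suc j + (n - Suc j) = n" using that by simp
    then have "drop (n - Suc j) (hist n) = hist (Suc j)" using drop[of "n - Suc j" "Suc j"] by (simp only:)
    then show ?thesis by (simp add: look_def hist_Suc)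
  qed
  have step: "hist (Suc n) = step n (hist n)" for n
    unfolding step_def hist_Suc F[of n] by (simp add: look)
  \<comment> \<open>\<open>hist\<close> is defined through \<open>F\<close>, whose recursiveness is
    the goal. In \<open>step\<close> the values of \<open>F\<close> are replaced by lookups in the
    history, so this equation makes \<open>hist\<close> recursive.\<close>
  have hist: "hist n = rec_nat 0 step n" for n
  proof (induction n)
    case (Suc n)
    then show ?case by (simp add: step)
  qed (simp add: hist_def)
  have "recursive2 drop" unfolding drop_def
    using recursive2_prim[of "\<lambda>c. c" "\<lambda>_ y _. psnd y"] by (simp add: rec_intros)
  note [rec_intros] = recursive2_app[of drop, OF this]
  have "recursive3 look"
    unfolding look_def by (intro rec_intros) simp_all
  note [rec_intros] = recursive3_app[of look, OF \<open>recursive3 look\<close>] recursive3_app[of G, OF G]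
    recursive1_app[of a, OF a] recursive1_app[of b, OF b]
  have "recursive1 (rec_nat 0 step)"
    unfolding step_def by (intro recursive1_prim rec_intros) simp_all
  note [rec_intros] = recursive1_app[of "rec_nat 0 step", OF this]
  have "recursive1 (\<lambda>n. pfst (rec_nat 0 step (Suc n)))"
    by (intro rec_intros) simp
  then show ?thesis by (rule recursive_cong) (simp only: hist[symmetric] hist_Suc prod_encode_inverse fst_conv)
qed

lemma computable_recursive1: "recursive1 f \<Longrightarrow> computable f"
  unfolding recursive_def computable_def
  by (metis One_nat_def length_Cons list.size(3) nth_Cons_0)

section \<open>Interpretations and many-one reductions\<close>

text \<open>A positive tag makes a code exceed its payload, and this lets recursion over codes of
  formulas terminate. Tag 0 belongs to \<open>Rel\<close>, whose payload contains no
  formula.\<close>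

lemma less_prod_encode: "0 < t \<Longrightarrow> u < prod_encode (t, u)"
proof -
  have "m \<le> triangle m" for m by (induction m) auto
  from this[of "t + u"] show "0 < t \<Longrightarrow> u < prod_encode (t, u)"
    by (simp add: prod_encode_def)
qed

lemma psnd_less: "0 < pfst n \<Longrightarrow> psnd n < n"
  using less_prod_encode[of "pfst n" "psnd n"] by simp

lemma pfst_le: "pfst n \<le> n" and psnd_le: "psnd n \<le> n"
  using le_prod_encode_1[of "pfst n" "psnd n"] le_prod_encode_2[of "psnd n" "pfst n"] by simp_all

text \<open>Numbers that are not codes of formulas decode to formulas containing the
  atom \<open>Rel 5 []\<close>, which is ill-formed in both signatures.\<close>

function decode :: "nat \<Rightarrow> fm" where
  "decode n =
    (if pfst n = 0 then Rel (pfst (psnd n)) (list_decode (psnd (psnd n)))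
     else if pfst n = 1 then Eq (pfst (psnd n)) (psnd (psnd n))
     else if pfst n = 2 then Neg (decode (psnd n))
     else if pfst n = 3 then Conj (decode (pfst (psnd n))) (decode (psnd (psnd n)))
     else if pfst n = 4 then Ex (pfst (psnd n)) (decode (psnd (psnd n)))
     else Rel 5 [])"
  by auto
termination
  by (relation "Wellfounded.measure id") (auto intro: psnd_less le_less_trans[OF pfst_le psnd_less] le_less_trans[OF psnd_le psnd_less])

declare decode.simps [simp del]

lemma decode_code [simp]: "decode (code \<phi>) = \<phi>"
  by (induction \<phi>) (simp_all add: decode.simps[of "prod_encode _"])

lemma code_decode: "sig 5 = None \<Longrightarrow> wf_fm sig (decode n) \<Longrightarrow> code (decode n) = n"
proof (induction n rule: decode.induct)
  case (1 n)
  have n: "prod_encode (t, psnd n) = n" if "pfst n = t" for t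
    using that by auto
  show ?case
    using 1 by (auto simp: decode.simps[of n] n split: if_splits)
qed

lemma sat_cong:
  "\<forall>x\<in>freevars \<phi>. e x = e' x \<Longrightarrow> sat D I e \<phi> = sat D I e' \<phi>"
proof (induction \<phi> arbitrary: e e')
  case (Rel r xs)
  then have "map e xs = map e' xs" by simp
  then show ?case by (simp only: sat.simps)
next
  case (Conj p q)
  then have "sat D I e p = sat D I e' p" "sat D I e q = sat D I e' q"
    by (metis UnCI freevars.simps(4))+
  then show ?case by simp
next
  case (Ex x \<phi>)
  have "sat D I (e(x := a)) \<phi> = sat D I (e'(x := a)) \<phi>" for a
    by (rule Ex.IH) (use Ex.prems in auto)
  then show ?case by simp
qed auto

text \<open>Since junk decodes to ill-formed formulas, membership is a condition on
  \<open>decode n\<close> for every \<open>n\<close>, and a reduction can work on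
  \<open>decode n\<close> without first testing whether \<open>n\<close> is a code.\<close>

lemma mem_FO_iff:
  assumes "sig 5 = None"
  shows "n \<in> FO sig D I \<longleftrightarrow> wf_fm sig (decode n) \<and> freevars (decode n) = {} \<and>
    (\<forall>e. (\<forall>v. e v \<in> D) \<longrightarrow> sat D I e (decode n))"
proof
  assume "n \<in> FO sig D I"
  then obtain \<phi> where "n = code \<phi>" "wf_fm sig \<phi>" "freevars \<phi> = {}"
    "\<forall>e. (\<forall>v. e v \<in> D) \<longrightarrow> sat D I e \<phi>"
    unfolding FO_def by blast
  then show "wf_fm sig (decode n) \<and> freevars (decode n) = {} \<and>
    (\<forall>e. (\<forall>v. e v \<in> D) \<longrightarrow> sat D I e (decode n))"
    by simp
next
  assume *: "wf_fm sig (decode n) \<and> freevars (decode n) = {} \<and>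
    (\<forall>e. (\<forall>v. e v \<in> D) \<longrightarrow> sat D I e (decode n))"
  then have "n = code (decode n)" using code_decode[of sig n, OF assms] by simp
  with * show "n \<in> FO sig D I" unfolding FO_def by blast
qed

text \<open>A semantic notion, so that formulas never have to be written out: the rules collected in
  \<open>def_intros\<close> follow the shape of the defined predicate. The bound \<open>n\<close>
  also serves as the next fresh variable.\<close>

definition definable ::
  "(nat \<Rightarrow> nat option) \<Rightarrow> 'a set \<Rightarrow> (nat \<Rightarrow> 'a list \<Rightarrow> bool) \<Rightarrow> nat \<Rightarrow> ((nat \<Rightarrow> 'a) \<Rightarrow> bool) \<Rightarrow> bool" where
  "definable sig D I n P \<longleftrightarrow> (\<exists>\<phi>. wf_fm sig \<phi> \<and> freevars \<phi> \<subseteq> {..<n} \<and>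
     (\<forall>e. (\<forall>v. e v \<in> D) \<longrightarrow> sat D I e \<phi> = P e))"

named_theorems def_intros

lemma definable_not [def_intros]:
  "definable sig D I n P \<Longrightarrow> definable sig D I n (\<lambda>e. \<not> P e)"
  unfolding definable_def by (metis wf_fm.simps(3) freevars.simps(3) sat.simps(3))

lemma definable_conj [def_intros]:
  assumes "definable sig D I n P" "definable sig D I n Q"
  shows "definable sig D I n (\<lambda>e. P e \<and> Q e)"
proof -
  from assms obtain \<phi> \<psi> where "wf_fm sig \<phi>" "freevars \<phi> \<subseteq> {..<n}" "\<forall>e. (\<forall>v. e v \<in> D) \<longrightarrow> sat D I e \<phi> = P e"
    "wf_fm sig \<psi>" "freevars \<psi> \<subseteq> {..<n}" "\<forall>e. (\<forall>v. e v \<in> D) \<longrightarrow> sat D I e \<psi> = Q e"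
    unfolding definable_def by blast
  then show ?thesis
    unfolding definable_def by (intro exI[of _ "Conj \<phi> \<psi>"]) auto
qed

lemma definable_cong:
  "definable sig D I n P \<Longrightarrow> (\<And>e. (\<And>v. e v \<in> D) \<Longrightarrow> P e = Q e) \<Longrightarrow> definable sig D I n Q"
  unfolding definable_def by metis

lemma definable_disj [def_intros]:
  assumes "definable sig D I n P" "definable sig D I n Q"
  shows "definable sig D I n (\<lambda>e. P e \<or> Q e)"
proof -
  have "definable sig D I n (\<lambda>e. \<not> (\<not> P e \<and> \<not> Q e))" by (intro def_intros assms)
  then show ?thesis by simp
qed

lemma definable_imp [def_intros]:
  assumes "definable sig D I n P" "definable sig D I n Q"
  shows "definable sig D I n (\<lambda>e. P e \<longrightarrow> Q e)"
proof -
  have "definable sig D I n (\<lambda>e. \<not> P e \<or> Q e)" by (intro def_intros assms)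
  then show ?thesis by simp
qed

lemma definable_iff [def_intros]:
  assumes "definable sig D I n P" "definable sig D I n Q"
  shows "definable sig D I n (\<lambda>e. P e \<longleftrightarrow> Q e)"
proof -
  have "definable sig D I n (\<lambda>e. (P e \<longrightarrow> Q e) \<and> (Q e \<longrightarrow> P e))" by (intro def_intros assms)
  then show ?thesis by (simp only: iff_conv_conj_imp)
qed

text \<open>The quantifier binds variable \<open>n\<close>, the first one beyond those in use. The
  second premise says that \<open>P\<close> does not itself read this variable, so that overwriting
  it is harmless.\<close>

lemma definable_ex [def_intros]:
  assumes "definable sig D I (Suc n) (\<lambda>e. P e (e n))"
    and "\<And>e a b. P (e(n := b)) a = P e a"
  shows "definable sig D I n (\<lambda>e. \<exists>a\<in>D. P e a)"
proof -
  from assms obtain \<phi> where "wf_fm sig \<phi>" "freevars \<phi> \<subseteq> {..<Suc n}"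
    "\<forall>e. (\<forall>v. e v \<in> D) \<longrightarrow> sat D I e \<phi> = P e (e n)"
    unfolding definable_def by blast
  then show ?thesis
    unfolding definable_def using assms(2)
    by (intro exI[of _ "Ex n \<phi>"]) (auto simp: lessThan_Suc)
qed

lemma definable_all [def_intros]:
  assumes "definable sig D I (Suc n) (\<lambda>e. P e (e n))"
    and "\<And>e a b. P (e(n := b)) a = P e a"
  shows "definable sig D I n (\<lambda>e. \<forall>a\<in>D. P e a)"
proof -
  have "definable sig D I n (\<lambda>e. \<not> (\<exists>a\<in>D. \<not> P e a))" using assms by (intro def_intros) auto
  then show ?thesis by simp
qed

lemma definable_eq [def_intros]:
  "x < n \<Longrightarrow> y < n \<Longrightarrow> definable sig D I n (\<lambda>e. e x = e y)"
  unfolding definable_def by (intro exI[of _ "Eq x y"]) auto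

lemma definable_rel:
  "sig r = Some (length xs) \<Longrightarrow> set xs \<subseteq> {..<n} \<Longrightarrow> definable sig D I n (\<lambda>e. I r (map e xs))"
  unfolding definable_def by (intro exI[of _ "Rel r xs"]) auto

section \<open>Translation of formulas along an interpretation with parameters\<close>

fun hd_default :: "'a \<Rightarrow> 'a list \<Rightarrow> 'a" where
  "hd_default d [] = d"
| "hd_default d (x # xs) = x"

text \<open>A short argument list is padded by repeating its last entry. Every atom of arity 1 to 3
  can then be instantiated uniformly, without acquiring new free variables.\<close>

definition "arg1 xs = hd_default 0 xs"
definition "arg2 xs = hd_default (arg1 xs) (tl xs)"
definition "arg3 xs = hd_default (arg2 xs) (tl (tl xs))"

lemma take_args:
  assumes "length xs \<in> {1, 2, 3}"
  shows "take (length xs) (map f [arg1 xs, arg2 xs, arg3 xs]) = map f xs"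
    and "{arg1 xs, arg2 xs, arg3 xs} = set xs"
proof -
  consider a where "xs = [a]" | a b where "xs = [a, b]" | a b c where "xs = [a, b, c]"
    using assms by (auto simp: length_Suc_conv numeral_2_eq_2 numeral_3_eq_3)
  then show "take (length xs) (map f [arg1 xs, arg2 xs, arg3 xs]) = map f xs"
    and "{arg1 xs, arg2 xs, arg3 xs} = set xs"
    by (cases; auto simp: arg1_def arg2_def arg3_def)+
qed

text \<open>In a translated formula the variables 0 to 7 hold parameters, the variables 8 to 10
  hold the arguments of an atomic formula, and the source variable \<open>x\<close> becomes \<open>x + 11\<close>.\<close>

definition inst :: "fm \<Rightarrow> nat \<Rightarrow> nat \<Rightarrow> nat \<Rightarrow> fm" where
  "inst \<theta> a b c = Ex 8 (Conj (Eq 8 (a + 11)) (Ex 9 (Conj (Eq 9 (b + 11))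
     (Ex 10 (Conj (Eq 10 (c + 11)) \<theta>)))))"

fun translate :: "(nat \<Rightarrow> nat option) \<Rightarrow> (nat \<Rightarrow> fm) \<Rightarrow> fm \<Rightarrow> fm \<Rightarrow> fm" where
  "translate sig \<theta> \<epsilon> (Rel r xs) =
    (if sig r = Some (length xs) then inst (\<theta> r) (arg1 xs) (arg2 xs) (arg3 xs) else Rel 5 [])"
| "translate sig \<theta> \<epsilon> (Eq x y) = inst \<epsilon> x y y"
| "translate sig \<theta> \<epsilon> (Neg p) = Neg (translate sig \<theta> \<epsilon> p)"
| "translate sig \<theta> \<epsilon> (Conj p q) = Conj (translate sig \<theta> \<epsilon> p) (translate sig \<theta> \<epsilon> q)"
| "translate sig \<theta> \<epsilon> (Ex x p) = Ex (x + 11) (translate sig \<theta> \<epsilon> p)"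

fun exs :: "nat \<Rightarrow> fm \<Rightarrow> fm" where
  "exs 0 \<phi> = \<phi>"
| "exs (Suc n) \<phi> = exs n (Ex n \<phi>)"

lemma wf_exs [simp]: "wf_fm sig (exs n \<phi>) = wf_fm sig \<phi>"
  by (induction n arbitrary: \<phi>) auto

lemma freevars_exs [simp]: "freevars (exs n \<phi>) = freevars \<phi> - {..<n}"
  by (induction n arbitrary: \<phi>) (auto simp: lessThan_Suc)

lemma sat_exs:
  "sat D I e (exs n \<phi>) \<longleftrightarrow> (\<exists>e'. (\<forall>v<n. e' v \<in> D) \<and> (\<forall>v\<ge>n. e' v = e v) \<and> sat D I e' \<phi>)"
proof (induction n arbitrary: \<phi>)
  case 0
  have "(\<forall>v. e' v = e v) \<longleftrightarrow> e' = e" for e' by auto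
  then show ?case by simp
next
  case (Suc n)
  have "(\<exists>e'. (\<forall>v<n. e' v \<in> D) \<and> (\<forall>v\<ge>n. e' v = e v) \<and> (\<exists>a\<in>D. sat D I (e'(n := a)) \<phi>)) \<longleftrightarrow>
    (\<exists>e'. (\<forall>v<Suc n. e' v \<in> D) \<and> (\<forall>v\<ge>Suc n. e' v = e v) \<and> sat D I e' \<phi>)" (is "?L \<longleftrightarrow> ?R")
  proof
    assume ?L
    then obtain e' a where "\<forall>v<n. e' v \<in> D" "\<forall>v\<ge>n. e' v = e v" "a \<in> D" "sat D I (e'(n := a)) \<phi>"
      by blast
    then show ?R by (intro exI[of _ "e'(n := a)"]) (auto simp: less_Suc_eq)
  next
    assume ?R
    then obtain e' where e': "\<forall>v<Suc n. e' v \<in> D" "\<forall>v\<ge>Suc n. e' v = e v" "sat D I e' \<phi>"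
      by blast
    have "\<forall>v>n. e' v = e v" using e'(2) by (simp add: Suc_le_eq)
    moreover have "(e'(n := e n))(n := e' n) = e'" by simp
    \<comment> \<open>The outer block has to agree with \<open>e\<close> from \<open>n\<close> on,
      so its witness restores \<open>e n\<close> there; the inner quantifier puts
      \<open>e' n\<close> back.\<close>
    ultimately show ?L using e'(1,3)
      by (intro exI[of _ "e'(n := e n)"] conjI bexI[of _ "e' n"]) (auto simp: le_less)
  qed
  then show ?case by (simp add: Suc)
qed

text \<open>Atoms of wrong arity go to \<open>Rel 5 []\<close>, which is ill-formed in the target.
  So ill-formed formulas stay ill-formed and cannot enter the target theory by accident.\<close>

lemma wf_translate:
  assumes "sig' 5 = None" "\<And>r. sig r \<noteq> None \<Longrightarrow> wf_fm sig' (\<theta> r)" "wf_fm sig' \<epsilon>"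
  shows "wf_fm sig' (translate sig \<theta> \<epsilon> \<phi>) = wf_fm sig \<phi>"
  using assms by (induction \<phi>) (auto simp: inst_def)

lemma freevars_inst:
  assumes "freevars \<theta> \<subseteq> {..<11}"
  shows "freevars (inst \<theta> a b c) - {..<8} = (\<lambda>x. x + 11) ` {a, b, c}"
proof -
  have "x < 8" if "x \<in> freevars \<theta> - {8, 9, 10}" for x
  proof -
    have "x < 11" "x \<noteq> 8" "x \<noteq> 9" "x \<noteq> 10" using that assms by auto
    then show ?thesis by arith
  qed
  then have "freevars \<theta> - {8, 9, 10} - {..<8} = {}" by blast
  moreover have "freevars (inst \<theta> a b c) = {a + 11, b + 11, c + 11} \<union> (freevars \<theta> - {8, 9, 10})"
    unfolding inst_def freevars.simps by auto
  moreover have "{a + 11, b + 11, c + 11} - {..<8} = {a + 11, b + 11, c + 11}" by auto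
  ultimately show ?thesis by (simp only: Un_Diff Un_empty_right image_insert image_empty)
qed

lemma freevars_translate:
  assumes "\<And>r l. sig r = Some l \<Longrightarrow> freevars (\<theta> r) \<subseteq> {..<11} \<and> l \<in> {1, 2, 3}" "freevars \<epsilon> \<subseteq> {..<11}"
    and "wf_fm sig \<phi>"
  shows "freevars (translate sig \<theta> \<epsilon> \<phi>) - {..<8} = (\<lambda>x. x + 11) ` freevars \<phi>"
  using assms(3)
proof (induction \<phi>)
  case (Rel r xs)
  show ?case using Rel assms(1)[of r] take_args(2)[of xs] by (simp add: freevars_inst del: image_insert)
next
  case (Eq x y)
  then show ?case using freevars_inst[OF assms(2), of x y y] by simp
next
  case (Ex x p)
  have "freevars (translate sig \<theta> \<epsilon> (fm.Ex x p)) - {..<8} = (freevars (translate sig \<theta> \<epsilon> p) - {..<8}) - {x + 11}"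
    by auto
  then show ?case using Ex by (auto simp: inj_image_mem_iff)
qed auto

lemma sat_inst:
  assumes "\<And>v. e v \<in> D"
  shows "sat D I e (inst \<theta> a b c) =
    sat D I (e(8 := e (a + 11), 9 := e (b + 11), 10 := e (c + 11))) \<theta>"
  using assms by (simp add: inst_def)

text \<open>Every element of \<open>D'\<close> names an element of \<open>D\<close> through
  \<open>h\<close>, and every element of \<open>D\<close> has a name. Hence quantifiers are
  translated without relativization, and the price is that equality becomes the kernel of
  \<open>h\<close>, expressed by \<open>\<epsilon>\<close>. The bound variables are at least 11, so
  the parameters stay fixed.\<close>

lemma sat_translate:
  assumes h: "h ` D' = D" and sig: "\<And>r l. sig r = Some l \<Longrightarrow> l \<in> {1, 2, 3}"
    and \<epsilon>: "\<And>e. (\<And>v. e v \<in> D') \<Longrightarrow> (\<And>v. v < 8 \<Longrightarrow> e v = p v) \<Longrightarrow> sat D' I' e \<epsilon> \<longleftrightarrow> h (e 8) = h (e 9)"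
    and \<theta>: "\<And>e r l. (\<And>v. e v \<in> D') \<Longrightarrow> (\<And>v. v < 8 \<Longrightarrow> e v = p v) \<Longrightarrow> sig r = Some l \<Longrightarrow>
      sat D' I' e (\<theta> r) \<longleftrightarrow> I r (take l [h (e 8), h (e 9), h (e 10)])"
    and "\<And>v. e v \<in> D'" "\<And>v. v < 8 \<Longrightarrow> e v = p v" "wf_fm sig \<phi>"
  shows "sat D' I' e (translate sig \<theta> \<epsilon> \<phi>) = sat D I (\<lambda>x. h (e (x + 11))) \<phi>"
  using assms(5-7)
proof (induction \<phi> arbitrary: e)
  case (Rel r xs)
  then have r: "sig r = Some (length xs)" by simp
  have "take (length xs) (map (\<lambda>x. h (e (x + 11))) [arg1 xs, arg2 xs, arg3 xs]) = map (\<lambda>x. h (e (x + 11))) xs"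
    using sig[OF r] by (rule take_args)
  then show ?case using Rel r by (simp add: sat_inst \<theta>[OF _ _ r])
next
  case (Eq x y)
  then show ?case by (simp add: sat_inst \<epsilon>)
next
  case (Ex x \<phi>)
  have "sat D' I' (e(x + 11 := b)) (translate sig \<theta> \<epsilon> \<phi>) =
      sat D I ((\<lambda>x. h (e (x + 11)))(x := h b)) \<phi>" if "b \<in> D'" for b
  proof -
    have "sat D' I' (e(x + 11 := b)) (translate sig \<theta> \<epsilon> \<phi>) =
      sat D I (\<lambda>y. h ((e(x + 11 := b)) (y + 11))) \<phi>"
      using that Ex.prems by (intro Ex.IH) auto
    also have "(\<lambda>y. h ((e(x + 11 := b)) (y + 11))) = (\<lambda>x. h (e (x + 11)))(x := h b)"
      by auto
    finally show ?thesis .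
  qed
  then show ?case by (simp flip: h)
qed auto

section \<open>Computability of the translation on codes\<close>

definition inst_code :: "nat \<Rightarrow> nat \<Rightarrow> nat \<Rightarrow> nat \<Rightarrow> nat" where
  "inst_code w a b c = prod_encode (4, prod_encode (8, prod_encode (3, prod_encode (
     prod_encode (1, prod_encode (8, a + 11)), prod_encode (4, prod_encode (9, prod_encode (3, prod_encode (
     prod_encode (1, prod_encode (9, b + 11)), prod_encode (4, prod_encode (10, prod_encode (3, prod_encode (
     prod_encode (1, prod_encode (10, c + 11)), w))))))))))))"

lemma code_inst: "code (inst \<theta> a b c) = inst_code (code \<theta>) a b c"
  by (simp add: inst_def inst_code_def)

lemma recursive_inst_code [rec_intros]:
  "recursive k f \<Longrightarrow> recursive k a \<Longrightarrow> recursive k b \<Longrightarrow> recursive k c \<Longrightarrow>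
    recursive k (\<lambda>xs. inst_code (f xs) (a xs) (b xs) (c xs))"
  unfolding inst_code_def by (intro rec_intros)

text \<open>\<open>list_encode\<close> sends the empty list to 0 and \<open>x # xs\<close> to the
  successor of a pair, hence the subtraction of 1.\<close>

abbreviation "code_hd d c \<equiv> if c = 0 then d else pfst (c - 1)"
abbreviation "code_tl c \<equiv> psnd (c - 1)"

text \<open>As \<open>prod_decode 0 = (0, 0)\<close>, also the empty list has itself as tail.\<close>

lemma list_encode_tl: "list_encode (tl xs) = code_tl (list_encode xs)"
proof -
  have "prod_decode 0 = (0, 0)"
    using prod_encode_inverse[of "(0, 0)"] by (simp add: prod_encode_def)
  then show ?thesis by (cases xs) auto
qed

lemma list_encode_eq_0: "list_encode xs = 0 \<longleftrightarrow> xs = []"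
  by (cases xs) auto

lemma code_hd_default: "hd_default d xs = code_hd d (list_encode xs)"
  by (cases xs) auto

text \<open>All lengths above 3 are merged into 5. This differs from every arity in use and from 4,
  which later stands for the absence of a relation symbol.\<close>

definition short_length :: "nat \<Rightarrow> nat" where
  "short_length c = (if c = 0 then 0 else if code_tl c = 0 then 1 else if code_tl (code_tl c) = 0 then 2
     else if code_tl (code_tl (code_tl c)) = 0 then 3 else 5)"

lemma short_length: "n \<in> {1, 2, 3, 4} \<Longrightarrow> n = short_length (list_encode xs) \<longleftrightarrow> n \<noteq> 4 \<and> n = length xs"
  unfolding short_length_def list_encode_tl[symmetric] list_encode_eq_0
  by (cases xs rule: list.exhaust[case_names Nil Cons];
      cases "tl xs"; cases "tl (tl xs)"; cases "tl (tl (tl xs))") auto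

text \<open>The value at \<open>n\<close> depends on the values at no more than two smaller codes,
  those of the immediate subformulas. \<open>\<theta>\<close> and \<open>sig\<close> enter through
  finite tables, since relation symbols lie below 5.\<close>

lemma recursive_translate:
  assumes sig: "\<And>r l. sig r = Some l \<Longrightarrow> r < 5 \<and> l \<in> {1, 2, 3}"
  shows "recursive1 (\<lambda>n. code (translate sig \<theta> \<epsilon> (decode n)))"
proof -
  define A where "A r = (case sig r of Some k \<Rightarrow> k | None \<Rightarrow> 4)" for r
  define w where "w r = (if r < 5 then code (\<theta> r) else 0)" for r
  define G where "G n p q =
    (if pfst n = 0 then if A (pfst (psnd n)) = short_length (psnd (psnd n)) then
        inst_code (w (pfst (psnd n))) (code_hd 0 (psnd (psnd n)))
          (code_hd (code_hd 0 (psnd (psnd n))) (code_tl (psnd (psnd n))))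
          (code_hd (code_hd (code_hd 0 (psnd (psnd n))) (code_tl (psnd (psnd n))))
            (code_tl (code_tl (psnd (psnd n)))))
        else code (Rel 5 [])
     else if pfst n = 1 then inst_code (code \<epsilon>) (pfst (psnd n)) (psnd (psnd n)) (psnd (psnd n))
     else if pfst n = 2 then prod_encode (2, p)
     else if pfst n = 3 then prod_encode (3, prod_encode (p, q))
     else if pfst n = 4 then prod_encode (4, prod_encode (pfst (psnd n) + 11, q))
     else code (Rel 5 []))" for n p q
  \<comment> \<open>The payload of a negation is itself the subformula code; a conjunction has its
    two subformulas in the halves of the payload; a quantifier has its variable in the first half
    and its body in the second.\<close>
  define a b where "a n = (if pfst n = 2 then psnd n else pfst (psnd n))" and "b n = psnd (psnd n)" for n
  have "sig r = None" if "5 \<le> r" for r using sig[of r] that by (cases "sig r") auto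
  then have rA: "recursive1 A" and rw: "recursive1 w"
    using recursive1_eventually_const[of 5 A 4] recursive1_eventually_const[of 5 w 0]
    by (simp_all add: A_def w_def)
  note [rec_intros] = recursive1_app[of A, OF rA] recursive1_app[of w, OF rw]
  have "recursive k (\<lambda>xs. short_length (f xs))" if "recursive k f" for k f
    unfolding short_length_def by (intro rec_intros that)
  note [rec_intros] = this
  have G: "recursive3 G" unfolding G_def by (intro rec_intros) simp_all
  have a: "recursive1 a" and b: "recursive1 b"
    unfolding a_def b_def by (intro rec_intros; simp)+
  have atom: "code (translate sig \<theta> \<epsilon> (Rel r xs)) =
     (if A r = short_length (list_encode xs) then
        inst_code (w r) (code_hd 0 (list_encode xs))
          (code_hd (code_hd 0 (list_encode xs)) (code_tl (list_encode xs)))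
          (code_hd (code_hd (code_hd 0 (list_encode xs)) (code_tl (list_encode xs)))
            (code_tl (code_tl (list_encode xs))))
        else code (Rel 5 []))" for r xs
  proof -
    have "A r = short_length (list_encode xs) \<longleftrightarrow> sig r = Some (length xs)"
      using sig[of r] short_length[of "A r" xs] by (cases "sig r") (auto simp: A_def)
    then show ?thesis using sig[of r]
      by (simp add: code_inst w_def arg1_def arg2_def arg3_def list_encode_tl code_hd_default del: code.simps)
  qed
  show ?thesis
  proof (rule recursive_course_of_values[OF G a b])
    fix n
    let ?F = "\<lambda>n. code (translate sig \<theta> \<epsilon> (decode n))"
    consider "pfst n = 0" | "pfst n = 1" | "pfst n = 2" | "pfst n = 3" | "pfst n = 4" | "4 < pfst n"
      by linarith
    then show "?F n = G n (if a n < n then ?F (a n) else 0) (if b n < n then ?F (b n) else 0)"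
    proof cases
      case 1
      then show ?thesis by (simp add: decode.simps[of n] G_def atom del: translate.simps code.simps)
    next
      case 2
      then show ?thesis by (simp add: decode.simps[of n] G_def code_inst)
    next
      case 3
      then show ?thesis using psnd_less[of n] by (simp add: decode.simps[of n] G_def a_def)
    next
      case 4
      then show ?thesis
        using le_less_trans[OF pfst_le psnd_less[of n]] le_less_trans[OF psnd_le psnd_less[of n]]
        by (simp add: decode.simps[of n] G_def a_def b_def)
    next
      case 5
      then show ?thesis using le_less_trans[OF psnd_le psnd_less[of n]]
        by (simp add: decode.simps[of n] G_def b_def)
    next
      case 6
      then show ?thesis using sig[of 5 0] by (auto simp: decode.simps[of n] G_def)
    qed
  qed
qed

lemma recursive_exs:
  "recursive1 (\<lambda>n. code (\<psi> n)) \<Longrightarrow> recursive1 (\<lambda>n. code (exs m (\<psi> n)))"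
proof (induction m arbitrary: \<psi>)
  case (Suc m)
  have "recursive1 (\<lambda>n. code (Ex m (\<psi> n)))"
    by (simp only: code.simps) (intro rec_intros Suc.prems)
  then show ?case using Suc.IH[of "\<lambda>n. Ex m (\<psi> n)"] by simp
qed simp

text \<open>Interpretation with parameters. The map \<open>h\<close> may depend on the parameters,
  but for a closed formula the right-hand side of \<open>sat_translate\<close> does not depend on
  the assignment. So truth for one admissible choice of parameters, truth for all of them and truth
  in \<open>D\<close> coincide; \<open>ex\<close> excludes the vacuous case.\<close>

lemma many_one_reducible_FO:
  fixes D :: "'a set" and D' :: "'b set"
  assumes sig: "\<And>r l. sig r = Some l \<Longrightarrow> r < 5 \<and> l \<in> {1, 2, 3}" and sig': "sig' 5 = None"
    and \<Psi>: "definable sig' D' I' 8 \<Psi>" and E: "definable sig' D' I' 11 E"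
    and R: "\<And>r. sig r \<noteq> None \<Longrightarrow> definable sig' D' I' 11 (R r)"
    and ex: "\<exists>e. (\<forall>v. e v \<in> D') \<and> \<Psi> e"
    and interp: "\<And>p. (\<And>v. p v \<in> D') \<Longrightarrow> \<Psi> p \<Longrightarrow> \<exists>h. h ` D' = D \<and>
      (\<forall>e. (\<forall>v. e v \<in> D') \<longrightarrow> (\<forall>v<8. e v = p v) \<longrightarrow> (E e \<longleftrightarrow> h (e 8) = h (e 9)) \<and>
        (\<forall>r l. sig r = Some l \<longrightarrow> (R r e \<longleftrightarrow> I r (take l [h (e 8), h (e 9), h (e 10)]))))"
  shows "many_one_reducible (FO sig D I) (FO sig' D' I')"
proof -
  from \<Psi> obtain \<psi> where \<psi>: "wf_fm sig' \<psi>" "freevars \<psi> \<subseteq> {..<8}"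
    "\<And>e. (\<And>v. e v \<in> D') \<Longrightarrow> sat D' I' e \<psi> = \<Psi> e"
    unfolding definable_def by blast
  from E obtain \<epsilon> where \<epsilon>: "wf_fm sig' \<epsilon>" "freevars \<epsilon> \<subseteq> {..<11}"
    "\<And>e. (\<And>v. e v \<in> D') \<Longrightarrow> sat D' I' e \<epsilon> = E e"
    unfolding definable_def by blast
  have "\<forall>r. \<exists>\<phi>. sig r \<noteq> None \<longrightarrow> wf_fm sig' \<phi> \<and> freevars \<phi> \<subseteq> {..<11} \<and>
     (\<forall>e. (\<forall>v. e v \<in> D') \<longrightarrow> sat D' I' e \<phi> = R r e)"
    using R unfolding definable_def by blast
  then obtain \<theta> where \<theta>: "\<And>r. sig r \<noteq> None \<Longrightarrow> wf_fm sig' (\<theta> r)"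
    "\<And>r. sig r \<noteq> None \<Longrightarrow> freevars (\<theta> r) \<subseteq> {..<11}"
    "\<And>r e. sig r \<noteq> None \<Longrightarrow> (\<And>v. e v \<in> D') \<Longrightarrow> sat D' I' e (\<theta> r) = R r e"
    by metis
  have sig5: "sig 5 = None" using sig[of 5] by (cases "sig 5") auto
  let ?T = "\<lambda>n. exs 8 (Conj \<psi> (translate sig \<theta> \<epsilon> (decode n)))"
  have "recursive1 (\<lambda>n. code (Conj \<psi> (translate sig \<theta> \<epsilon> (decode n))))"
    using recursive_translate[OF sig] by (simp add: rec_intros)
  then have "computable (\<lambda>n. code (?T n))"
    by (intro computable_recursive1 recursive_exs)
  moreover have "n \<in> FO sig D I \<longleftrightarrow> code (?T n) \<in> FO sig' D' I'" for n
  proof (cases "wf_fm sig (decode n)")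
    case False
    then show ?thesis
      using wf_translate[of sig' sig \<theta> \<epsilon> "decode n"] sig' \<theta>(1) \<epsilon>(1) by (simp add: mem_FO_iff sig5)
  next
    case wf: True
    let ?\<phi> = "decode n"
    have fv: "freevars (?T n) = {} \<longleftrightarrow> freevars ?\<phi> = {}"
    proof -
      have "freevars (translate sig \<theta> \<epsilon> ?\<phi>) - {..<8} = (\<lambda>x. x + 11) ` freevars ?\<phi>"
        by (rule freevars_translate) (use \<theta> sig \<epsilon> wf in auto)
      moreover have "freevars \<psi> - {..<8} = {}" using \<psi>(2) by blast
      ultimately have "freevars (?T n) = (\<lambda>x. x + 11) ` freevars ?\<phi>"
        by (simp only: freevars_exs freevars.simps Un_Diff Un_empty_left)
      then show ?thesis by (simp only: image_is_empty)
    qed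
    have key: "(\<forall>e. (\<forall>v. e v \<in> D) \<longrightarrow> sat D I e ?\<phi>) \<longleftrightarrow> (\<forall>e. (\<forall>v. e v \<in> D') \<longrightarrow> sat D' I' e (?T n))"
      (is "?L \<longleftrightarrow> ?R") if closed: "freevars ?\<phi> = {}"
    proof -
      have tr: "\<exists>h. h ` D' = D \<and> sat D' I' e (translate sig \<theta> \<epsilon> ?\<phi>) = sat D I (\<lambda>x. h (e (x + 11))) ?\<phi>"
        if e: "\<And>v. e v \<in> D'" "\<Psi> e" for e
      proof -
        from interp[OF e] obtain h where h: "h ` D' = D"
          and h': "\<forall>e'. (\<forall>v. e' v \<in> D') \<longrightarrow> (\<forall>v<8. e' v = e v) \<longrightarrow> (E e' \<longleftrightarrow> h (e' 8) = h (e' 9)) \<and>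
            (\<forall>r l. sig r = Some l \<longrightarrow> (R r e' \<longleftrightarrow> I r (take l [h (e' 8), h (e' 9), h (e' 10)])))"
          by (elim exE conjE)
        have "sat D' I' e (translate sig \<theta> \<epsilon> ?\<phi>) = sat D I (\<lambda>x. h (e (x + 11))) ?\<phi>"
        proof (rule sat_translate[of h, where p = e])
          fix e' assume e': "\<And>v. e' v \<in> D'" "\<And>v. v < 8 \<Longrightarrow> e' v = e v"
          note h'' = h'[rule_format, of e', OF e']
          show "sat D' I' e' \<epsilon> \<longleftrightarrow> h (e' 8) = h (e' 9)"
            using \<epsilon>(3)[of e', OF e'(1)] h'' by (simp only:)
          show "sat D' I' e' (\<theta> r) \<longleftrightarrow> I r (take l [h (e' 8), h (e' 9), h (e' 10)])" if "sig r = Some l" for r l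
            using \<theta>(3)[of r e', OF _ e'(1)] h'' that by simp
        qed (use h e(1) sig wf in auto)
        with h show ?thesis by blast
      qed
      from ex obtain p where p: "\<And>v. p v \<in> D'" "\<Psi> p" by blast
      show ?thesis
      proof
        assume ?L
        show ?R
        proof (intro allI impI)
          fix e :: "nat \<Rightarrow> 'b" assume e: "\<forall>v. e v \<in> D'"
          \<comment> \<open>The witness for \<open>exs 8\<close> must agree with \<open>e\<close>
            from 8 on, so only the parameter slots take values from \<open>p\<close>.\<close>
          define e' where "e' = (\<lambda>v. if v < 8 then p v else e v)"
          have e': "e' v \<in> D'" for v using e p by (simp add: e'_def)
          have "sat D' I' e' \<psi> = sat D' I' p \<psi>"
            using \<psi>(2) by (intro sat_cong) (auto simp: e'_def)
          then have "\<Psi> e'" using \<psi>(3) e' p by simp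
          then have "sat D' I' e' (translate sig \<theta> \<epsilon> ?\<phi>)"
          proof -
            obtain h where h: "h ` D' = D"
              and "sat D' I' e' (translate sig \<theta> \<epsilon> ?\<phi>) = sat D I (\<lambda>x. h (e' (x + 11))) ?\<phi>"
              using tr[OF e' \<open>\<Psi> e'\<close>] by (elim exE conjE)
            moreover have "h (e' (x + 11)) \<in> D" for x using h e' by blast
            ultimately show ?thesis using \<open>?L\<close> by simp
          qed
          then show "sat D' I' e (?T n)"
            unfolding sat_exs
            using e' \<psi>(3)[of e'] \<open>\<Psi> e'\<close> e' by (intro exI[of _ e']) (simp add: e'_def[THEN fun_cong] p)
        qed
      next
        assume ?R
        then have "sat D' I' p (?T n)" using p by blast
        then obtain e where "\<forall>v<8. e v \<in> D'" "\<forall>v\<ge>8. e v = p v"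
          and e: "sat D' I' e \<psi>" "sat D' I' e (translate sig \<theta> \<epsilon> ?\<phi>)"
          unfolding sat_exs by auto
        then have "e v \<in> D'" for v using p(1) by (cases "v < 8") auto
        then obtain h where "sat D I (\<lambda>x. h (e (x + 11))) ?\<phi>"
          using tr[of e] \<psi>(3)[of e] e by blast
        then have "sat D I e' ?\<phi>" for e'
          using sat_cong[of ?\<phi> e' "\<lambda>x. h (e (x + 11))"] closed by simp
        then show ?L by blast
      qed
    qed
    show ?thesis
      using wf wf_translate[of sig' sig \<theta> \<epsilon> ?\<phi>] sig' \<theta>(1) \<epsilon>(1) \<psi>(1) fv key
      by (auto simp: mem_FO_iff[of sig] mem_FO_iff[of sig'] sig5 simp del: freevars_exs)
  qed
  ultimately show ?thesis unfolding many_one_reducible_def by blast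
qed

section \<open>Second-order arithmetic in a lattice of upsets\<close>

definition upsets :: "'a set set \<Rightarrow> 'a set set set" where
  "upsets K = {U. U \<subseteq> K \<and> (\<forall>F\<in>U. \<forall>G\<in>K. F \<subseteq> G \<longrightarrow> G \<in> U)}"

definition up :: "'a set set \<Rightarrow> 'a set \<Rightarrow> 'a set set" where
  "up K F = {G \<in> K. F \<subseteq> G}"

definition sub_rel :: "nat \<Rightarrow> 'a set list \<Rightarrow> bool" where
  "sub_rel r xs \<longleftrightarrow> r = 0 \<and> length xs = 2 \<and> xs ! 0 \<subseteq> xs ! 1"

text \<open>\<open>cji\<close>: completely join-irreducible; \<open>num D X\<close>: the maximal such elements below \<open>X\<close>.
  Maximality makes the numbers an antichain, so that a union of numbers contains no further numbers.\<close>

definition cji :: "'a set set \<Rightarrow> 'a set \<Rightarrow> bool" where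
  "cji D U \<longleftrightarrow> (\<exists>V\<in>D. V \<subseteq> U \<and> V \<noteq> U \<and> (\<forall>W\<in>D. W \<subseteq> U \<and> W \<noteq> U \<longrightarrow> W \<subseteq> V))"

definition num :: "'a set set \<Rightarrow> 'a set \<Rightarrow> 'a set \<Rightarrow> bool" where
  "num D X U \<longleftrightarrow> cji D U \<and> U \<subseteq> X \<and> (\<forall>W\<in>D. cji D W \<and> W \<subseteq> X \<and> U \<subseteq> W \<longrightarrow> U = W)"

text \<open>In a lattice of upsets \<open>meet2_le D a b M\<close> means \<open>a \<inter> b \<subseteq> M\<close>, expressed by inclusion alone.\<close>

definition meet2_le :: "'a set set \<Rightarrow> 'a set \<Rightarrow> 'a set \<Rightarrow> 'a set \<Rightarrow> bool" where
  "meet2_le D a b M \<longleftrightarrow> (\<forall>w\<in>D. w \<subseteq> a \<and> w \<subseteq> b \<longrightarrow> w \<subseteq> M)"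

definition meet3_le :: "'a set set \<Rightarrow> 'a set \<Rightarrow> 'a set \<Rightarrow> 'a set \<Rightarrow> 'a set \<Rightarrow> bool" where
  "meet3_le D a b c M \<longleftrightarrow> (\<forall>w\<in>D. w \<subseteq> a \<and> w \<subseteq> b \<and> w \<subseteq> c \<longrightarrow> w \<subseteq> M)"

text \<open>The number \<open>y\<close> of the family \<open>Y\<close> is the copy of \<open>b\<close>, and \<open>z\<close> that of \<open>c\<close>: distinct families
  tell the arguments of the relation coded by \<open>R\<close> apart.\<close>

definition rel3 :: "'a set set \<Rightarrow> 'a set \<Rightarrow> 'a set \<Rightarrow> 'a set \<Rightarrow> 'a set \<Rightarrow> 'a set \<Rightarrow> 'a set \<Rightarrow> 'a set \<Rightarrow> bool" where
  "rel3 D Y Z M R a b c \<longleftrightarrow> (\<exists>y\<in>D. \<exists>z\<in>D. num D Y y \<and> num D Z z \<and>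
     meet2_le D b y M \<and> meet2_le D c z M \<and> meet3_le D a y z R)"

text \<open>The second-order Peano axioms with zero \<open>z\<close> and one \<open>s\<close>. The last clause supplies an open set \<open>t\<close>
  such that \<open>a \<union> t\<close> codes the singleton of \<open>a\<close> without being a number itself.\<close>

definition arith_model ::
  "'a set set \<Rightarrow> 'a set \<Rightarrow> 'a set \<Rightarrow> 'a set \<Rightarrow> 'a set \<Rightarrow> 'a set \<Rightarrow> 'a set \<Rightarrow> 'a set \<Rightarrow> 'a set \<Rightarrow> bool" where
  "arith_model D X Y Z M A B z s \<longleftrightarrow>
     num D X z \<and> num D X s \<and>
     (\<forall>a\<in>D. num D X a \<longrightarrow> (\<exists>b\<in>D. num D X b \<and> rel3 D Y Z M A a s b)) \<and>
     (\<forall>a\<in>D. num D X a \<longrightarrow> (\<forall>b\<in>D. num D X b \<longrightarrow> (\<forall>c\<in>D. num D X c \<longrightarrow>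
        rel3 D Y Z M A a s b \<and> rel3 D Y Z M A a s c \<longrightarrow> b = c))) \<and>
     (\<forall>a\<in>D. num D X a \<longrightarrow> \<not> rel3 D Y Z M A a s z) \<and>
     (\<forall>a\<in>D. num D X a \<longrightarrow> (\<forall>b\<in>D. num D X b \<longrightarrow> (\<forall>c\<in>D. num D X c \<longrightarrow>
        rel3 D Y Z M A a s c \<and> rel3 D Y Z M A b s c \<longrightarrow> a = b))) \<and>
     (\<forall>V\<in>D. z \<subseteq> V \<and> (\<forall>a\<in>D. num D X a \<longrightarrow> (\<forall>b\<in>D. num D X b \<longrightarrow>
        rel3 D Y Z M A a s b \<and> a \<subseteq> V \<longrightarrow> b \<subseteq> V)) \<longrightarrow> (\<forall>a\<in>D. num D X a \<longrightarrow> a \<subseteq> V)) \<and>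
     (\<forall>a\<in>D. num D X a \<longrightarrow> (\<forall>c\<in>D. num D X c \<longrightarrow> (rel3 D Y Z M A a z c \<longleftrightarrow> c = a))) \<and>
     (\<forall>a\<in>D. num D X a \<longrightarrow> (\<forall>b\<in>D. num D X b \<longrightarrow> (\<forall>b'\<in>D. num D X b' \<longrightarrow> (\<forall>c'\<in>D. num D X c' \<longrightarrow>
        rel3 D Y Z M A b s b' \<longrightarrow> (rel3 D Y Z M A a b' c' \<longleftrightarrow>
          (\<exists>c\<in>D. num D X c \<and> rel3 D Y Z M A a b c \<and> rel3 D Y Z M A c s c')))))) \<and>
     (\<forall>a\<in>D. num D X a \<longrightarrow> (\<forall>c\<in>D. num D X c \<longrightarrow> (rel3 D Y Z M B a z c \<longleftrightarrow> c = z))) \<and>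
     (\<forall>a\<in>D. num D X a \<longrightarrow> (\<forall>b\<in>D. num D X b \<longrightarrow> (\<forall>b'\<in>D. num D X b' \<longrightarrow> (\<forall>c'\<in>D. num D X c' \<longrightarrow>
        rel3 D Y Z M A b s b' \<longrightarrow> (rel3 D Y Z M B a b' c' \<longleftrightarrow>
          (\<exists>c\<in>D. num D X c \<and> rel3 D Y Z M B a b c \<and> rel3 D Y Z M A c a c')))))) \<and>
     (\<exists>t\<in>D. \<forall>a\<in>D. num D X a \<longrightarrow> \<not> a \<subseteq> t \<and> \<not> t \<subseteq> a)"

section \<open>Definability of the lattice notions from inclusion\<close>

abbreviation "def_sub D \<equiv> definable sig_subset D sub_rel"

lemma definable_subset [def_intros]:
  assumes "x < n" "y < n"
  shows "def_sub D n (\<lambda>e. e x \<subseteq> e y)"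
  using definable_rel[of sig_subset 0 "[x, y]" n D sub_rel] assms
  by (simp add: sub_rel_def sig_subset_def)

lemma definable_cji [def_intros]:
  assumes "x < n" shows "def_sub D n (\<lambda>e. cji D (e x))"
  unfolding cji_def by (intro def_intros) (use assms in simp_all)

lemma definable_num [def_intros]:
  assumes "x < n" "y < n" shows "def_sub D n (\<lambda>e. num D (e x) (e y))"
  unfolding num_def by (intro def_intros) (use assms in simp_all)

lemma definable_meet2_le [def_intros]:
  assumes "a < n" "b < n" "m < n" shows "def_sub D n (\<lambda>e. meet2_le D (e a) (e b) (e m))"
  unfolding meet2_le_def by (intro def_intros) (use assms in simp_all)

lemma definable_meet3_le [def_intros]:
  assumes "a < n" "b < n" "c < n" "m < n" shows "def_sub D n (\<lambda>e. meet3_le D (e a) (e b) (e c) (e m))"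
  unfolding meet3_le_def by (intro def_intros) (use assms in simp_all)

lemma definable_rel3 [def_intros]:
  assumes "y < n" "z < n" "m < n" "r < n" "a < n" "b < n" "c < n"
  shows "def_sub D n (\<lambda>e. rel3 D (e y) (e z) (e m) (e r) (e a) (e b) (e c))"
  unfolding rel3_def by (intro def_intros) (use assms in simp_all)

text \<open>The three families, the matching, the two operations, zero and one fill exactly the
  eight parameter variables of the translation.\<close>

lemma definable_arith_model:
  "def_sub D 8 (\<lambda>e. arith_model D (e 0) (e 1) (e 2) (e 3) (e 4) (e 5) (e 6) (e 7))"
  unfolding arith_model_def by (intro def_intros) simp_all

text \<open>Dedekind's categoricity argument for operations given as graphs. \<open>f\<close>
  iterates the successor from \<open>z\<close>: induction makes it surjective, the two successor
  axioms make it injective, and the recursion equations then fix \<open>A\<close> and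
  \<open>B\<close> by induction on the second argument.\<close>

lemma peano_model:
  assumes N: "z \<in> N" "s \<in> N"
    and S_ex: "\<And>a. a \<in> N \<Longrightarrow> \<exists>b\<in>N. A a s b"
    and S_fun: "\<And>a b c. a \<in> N \<Longrightarrow> b \<in> N \<Longrightarrow> c \<in> N \<Longrightarrow> A a s b \<Longrightarrow> A a s c \<Longrightarrow> b = c"
    and S_z: "\<And>a. a \<in> N \<Longrightarrow> \<not> A a s z"
    and S_inj: "\<And>a b c. a \<in> N \<Longrightarrow> b \<in> N \<Longrightarrow> c \<in> N \<Longrightarrow> A a s c \<Longrightarrow> A b s c \<Longrightarrow> a = b"
    and ind: "\<And>P a. P z \<Longrightarrow> (\<And>a b. a \<in> N \<Longrightarrow> b \<in> N \<Longrightarrow> A a s b \<Longrightarrow> P a \<Longrightarrow> P b) \<Longrightarrow> a \<in> N \<Longrightarrow> P a"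
    and A_z: "\<And>a c. a \<in> N \<Longrightarrow> c \<in> N \<Longrightarrow> A a z c \<longleftrightarrow> c = a"
    and A_S: "\<And>a b b' c'. a \<in> N \<Longrightarrow> b \<in> N \<Longrightarrow> b' \<in> N \<Longrightarrow> c' \<in> N \<Longrightarrow> A b s b' \<Longrightarrow>
      A a b' c' \<longleftrightarrow> (\<exists>c\<in>N. A a b c \<and> A c s c')"
    and B_z: "\<And>a c. a \<in> N \<Longrightarrow> c \<in> N \<Longrightarrow> B a z c \<longleftrightarrow> c = z"
    and B_S: "\<And>a b b' c'. a \<in> N \<Longrightarrow> b \<in> N \<Longrightarrow> b' \<in> N \<Longrightarrow> c' \<in> N \<Longrightarrow> A b s b' \<Longrightarrow>
      B a b' c' \<longleftrightarrow> (\<exists>c\<in>N. B a b c \<and> A c a c')"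
  obtains f :: "nat \<Rightarrow> 'a" where "bij_betw f UNIV N"
    "\<And>m n k. A (f m) (f n) (f k) \<longleftrightarrow> k = m + n" "\<And>m n k. B (f m) (f n) (f k) \<longleftrightarrow> k = m * n"
proof -
  from S_ex obtain S where S: "\<And>a. a \<in> N \<Longrightarrow> S a \<in> N \<and> A a s (S a)" by metis
  define f where "f n = (S ^^ n) z" for n
  have f_0: "f 0 = z" and f_Suc: "f (Suc n) = S (f n)" for n by (simp_all add: f_def)
  have fN: "f n \<in> N" for n by (induction n) (use N S in \<open>auto simp: f_0 f_Suc\<close>)
  have AS: "A a s b \<longleftrightarrow> b = S a" if "a \<in> N" "b \<in> N" for a b
    using S[OF that(1)] S_fun that by blast
  have surj: "a \<in> range f" if "a \<in> N" for a
    using _ _ that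
  proof (rule ind)
    show "z \<in> range f" using f_0 by (metis rangeI)
    show "b \<in> range f" if "a \<in> N" "b \<in> N" "A a s b" "a \<in> range f" for a b
    proof -
      from that obtain n where "a = f n" by auto
      then have "b = f (Suc n)" using AS that f_Suc by simp
      then show ?thesis by simp
    qed
  qed
  have inj: "f m = f n \<Longrightarrow> m = n" for m n
  proof (induction m arbitrary: n)
    case 0
    then show ?case
      using S_z[OF fN] S[OF fN] by (cases n) (auto simp: f_0 f_Suc)
  next
    case (Suc m)
    show ?case
    proof (cases n)
      case 0
      then show ?thesis using Suc.prems S_z[OF fN[of m]] S[OF fN[of m]] by (simp add: f_0 f_Suc)
    next
      case (Suc k)
      then have "A (f m) s (f n)" "A (f k) s (f n)"
        using Suc.prems S[OF fN] by (metis f_Suc)+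
      then have "f m = f k" using S_inj fN by blast
      then show ?thesis using Suc.IH Suc by simp
    qed
  qed
  have f_eq: "f m = f n \<longleftrightarrow> m = n" for m n using inj by blast
  have bex: "(\<exists>c\<in>N. P c) \<longleftrightarrow> (\<exists>n. P (f n))" for P using surj fN by blast
  have step: "A (f n) s (f (Suc n))" for n using S[OF fN] f_Suc by simp
  have S_iff: "A (f j) s (f k) \<longleftrightarrow> k = Suc j" for j k
    using AS[OF fN fN, of j k] by (simp add: f_eq flip: f_Suc)
  have add: "A (f m) (f n) (f k) \<longleftrightarrow> k = m + n" for m n k
  proof (induction n arbitrary: k)
    case 0
    show ?case using A_z[OF fN fN, of m k] by (simp add: f_0 f_eq)
  next
    case (Suc n)
    show ?case
      using A_S[OF fN fN fN fN step, of m n k] by (simp add: bex Suc S_iff)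
  qed
  have mult: "B (f m) (f n) (f k) \<longleftrightarrow> k = m * n" for m n k
  proof (induction n arbitrary: k)
    case 0
    show ?case using B_z[OF fN fN, of m k] by (simp add: f_0[symmetric] f_eq)
  next
    case (Suc n)
    show ?case
      using B_S[OF fN fN fN fN step, of m n k] by (simp add: bex Suc add add.commute)
  qed
  have "bij_betw f UNIV N"
    using inj surj fN by (auto simp: bij_betw_def intro: injI)
  then show thesis using that add mult by blast
qed

section \<open>Completely join-irreducible elements of a lattice of upsets\<close>

lemma Union_upsets: "\<U> \<subseteq> upsets K \<Longrightarrow> \<Union>\<U> \<in> upsets K"
  unfolding upsets_def by blast

lemma up_upsets: "up K F \<in> upsets K"
  unfolding upsets_def up_def by blast

lemma up_subset_iff: "F \<in> K \<Longrightarrow> U \<in> upsets K \<Longrightarrow> up K F \<subseteq> U \<longleftrightarrow> F \<in> U"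
  unfolding upsets_def up_def by blast

text \<open>The largest upset properly inside \<open>up K F\<close> is \<open>up K F - {F}\<close>.
  Conversely, if \<open>V\<close> is the largest one properly inside \<open>U\<close>, any
  \<open>F\<close> in \<open>U - V\<close> generates \<open>U\<close>, because a smaller
  \<open>up K F\<close> would be contained in \<open>V\<close>.\<close>

lemma cji_upsets_iff:
  assumes "U \<in> upsets K"
  shows "cji (upsets K) U \<longleftrightarrow> (\<exists>F\<in>K. U = up K F)"
proof
  assume "cji (upsets K) U"
  then obtain V where V: "V \<subseteq> U" "V \<noteq> U" "\<forall>W\<in>upsets K. W \<subseteq> U \<and> W \<noteq> U \<longrightarrow> W \<subseteq> V"
    unfolding cji_def by (elim bexE conjE)
  then obtain F where F: "F \<in> U" "F \<notin> V" by blast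
  then have "F \<in> K" "up K F \<subseteq> U" "F \<in> up K F" using assms unfolding upsets_def up_def by auto
  moreover have "up K F = U"
  proof (rule ccontr)
    assume "up K F \<noteq> U"
    with bspec[OF V(3) up_upsets, of F] \<open>up K F \<subseteq> U\<close> have "up K F \<subseteq> V" by simp
    with \<open>F \<in> up K F\<close> F(2) show False by blast
  qed
  ultimately show "\<exists>F\<in>K. U = up K F" by (intro bexI[of _ F]) simp_all
next
  assume "\<exists>F\<in>K. U = up K F"
  then obtain F where F: "F \<in> K" "U = up K F" by blast
  have "up K F - {F} \<in> upsets K" unfolding upsets_def up_def by auto
  moreover have "W \<subseteq> up K F - {F}" if "W \<in> upsets K" "W \<subseteq> U" "W \<noteq> U" for W
    using that F up_subset_iff[OF F(1) that(1)] by auto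
  moreover have "up K F - {F} \<noteq> U" using F by (auto simp: up_def)
  ultimately show "cji (upsets K) U" unfolding cji_def using F(2) by blast
qed

text \<open>Numbers are completely join-prime: a principal upset covered by a union lies inside any
  member that contains its generator.\<close>

lemma num_Union:
  assumes "num (upsets K) X a" "a \<in> upsets K" "\<U> \<subseteq> upsets K" "a \<subseteq> \<Union>\<U>"
  shows "\<exists>U\<in>\<U>. a \<subseteq> U"
proof -
  have "cji (upsets K) a" using assms(1) by (simp add: num_def)
  then obtain F where F: "F \<in> K" "a = up K F"
    using cji_upsets_iff[OF assms(2)] by blast
  then have "F \<in> \<Union>\<U>" using assms(4) by (auto simp: up_def)
  then obtain U where "U \<in> \<U>" "F \<in> U" by blast
  then show ?thesis using up_subset_iff[OF F(1), of U] F(2) assms(3) by blast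
qed

lemma num_subset_num: "num D X a \<Longrightarrow> num D X b \<Longrightarrow> b \<in> D \<Longrightarrow> a \<subseteq> b \<Longrightarrow> a = b"
  unfolding num_def by blast

text \<open>The variables 0 to 5 hold \<open>X\<close>, \<open>Y\<close>, \<open>Z\<close>, the matching of the families, and the codes of addition and
  multiplication.\<close>

definition N2_interp :: "'a set set \<Rightarrow> nat \<Rightarrow> (nat \<Rightarrow> 'a set) \<Rightarrow> bool" where
  "N2_interp D r e =
    (if r = 0 then num D (e 0) (e 8)
     else if r = 1 then \<not> num D (e 0) (e 8)
     else if r = 2 then num D (e 0) (e 8) \<and> \<not> num D (e 0) (e 9) \<and> e 8 \<subseteq> e 9
     else num D (e 0) (e 8) \<and> num D (e 0) (e 9) \<and> num D (e 0) (e 10) \<and>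
       rel3 D (e 1) (e 2) (e 3) (if r = 3 then e 4 else e 5) (e 8) (e 9) (e 10))"

text \<open>Different open sets can have the same numbers below them and then code the same set, so
  equality of sets is extensional, while numbers are compared as they are.\<close>

definition N2_interp_eq :: "'a set set \<Rightarrow> (nat \<Rightarrow> 'a set) \<Rightarrow> bool" where
  "N2_interp_eq D e \<longleftrightarrow> (num D (e 0) (e 8) \<and> e 8 = e 9) \<or>
     (\<not> num D (e 0) (e 8) \<and> \<not> num D (e 0) (e 9) \<and>
      (\<forall>a\<in>D. num D (e 0) a \<longrightarrow> (a \<subseteq> e 8 \<longleftrightarrow> a \<subseteq> e 9)))"

lemma definable_N2_interp_eq: "def_sub D 11 (N2_interp_eq D)"
  unfolding N2_interp_eq_def[abs_def] by (intro def_intros) simp_all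

lemma definable_N2_interp: "def_sub D 11 (N2_interp D r)"
proof -
  consider "r = 0" | "r = 1" | "r = 2" | "r = 3" | "r \<noteq> 0" "r \<noteq> 1" "r \<noteq> 2" "r \<noteq> 3" by blast
  then show ?thesis
    by cases (simp_all add: N2_interp_def[abs_def] def_intros)
qed

lemma sig_N2_cases:
  assumes "sig_N2 r = Some l"
  obtains "r = 0" "l = 1" | "r = 1" "l = 1" | "r = 2" "l = 2" | "r = 3" "l = 3" | "r = 4" "l = 3"
  using assms by (auto simp: sig_N2_def split: if_splits)

lemma N2_rel_simps:
  "N2_rel 0 [x] = isl x" "N2_rel 1 [x] = (\<not> isl x)"
  "N2_rel 2 [x, y] = (\<exists>n A. x = Inl n \<and> y = Inr A \<and> n \<in> A)"
  "N2_rel 3 [x, y, z] = (\<exists>a b. x = Inl a \<and> y = Inl b \<and> z = Inl (a + b))"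
  "N2_rel 4 [x, y, z] = (\<exists>a b. x = Inl a \<and> y = Inl b \<and> z = Inl (a * b))"
  by (simp_all add: eval_nat_numeral)

text \<open>\<open>h\<close> reads a number as its index and any other upset as the set of indices
  of the numbers below it. The argument applies to every choice of parameters that satisfies the
  axioms, not just to the intended one.\<close>

lemma arith_model_interp:
  fixes K :: "'a set set" and p :: "nat \<Rightarrow> 'a set set"
  defines "D \<equiv> upsets K"
  assumes model: "arith_model D (p 0) (p 1) (p 2) (p 3) (p 4) (p 5) (p 6) (p 7)"
    and p: "\<And>v. p v \<in> D"
  shows "\<exists>h. h ` D = (UNIV :: (nat + nat set) set) \<and>
      (\<forall>e. (\<forall>v. e v \<in> D) \<longrightarrow> (\<forall>v<8. e v = p v) \<longrightarrow> (N2_interp_eq D e \<longleftrightarrow> h (e 8) = h (e 9)) \<and>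
        (\<forall>r l. sig_N2 r = Some l \<longrightarrow> (N2_interp D r e \<longleftrightarrow> N2_rel r (take l [h (e 8), h (e 9), h (e 10)]))))"
proof -
  define X where "X = p 0"
  define A where "A = rel3 D (p 1) (p 2) (p 3) (p 4)"
  define B where "B = rel3 D (p 1) (p 2) (p 3) (p 5)"
  define N where "N = {a\<in>D. num D X a}"
  note m = model[unfolded arith_model_def, folded X_def A_def B_def]
  have num_N: "num D X a \<longleftrightarrow> a \<in> N" if "a \<in> D" for a using that by (simp add: N_def)
  have bex: "(\<exists>a\<in>D. num D X a \<and> P a) \<longleftrightarrow> (\<exists>a\<in>N. P a)" for P by (auto simp: N_def)
  have ball: "(\<forall>a\<in>D. num D X a \<longrightarrow> P a) \<longleftrightarrow> (\<forall>a\<in>N. P a)" for P by (auto simp: N_def)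
  note m = m[unfolded bex ball]
  note m1 = m[THEN conjunct1]
  note m2 = m[THEN conjunct2, THEN conjunct1]
  note m3 = m[THEN conjunct2, THEN conjunct2, THEN conjunct1]
  note m4 = m[THEN conjunct2, THEN conjunct2, THEN conjunct2, THEN conjunct1]
  note m5 = m[THEN conjunct2, THEN conjunct2, THEN conjunct2, THEN conjunct2, THEN conjunct1]
  note m6 = m[THEN conjunct2, THEN conjunct2, THEN conjunct2, THEN conjunct2, THEN conjunct2, THEN conjunct1]
  note m7 = m[THEN conjunct2, THEN conjunct2, THEN conjunct2, THEN conjunct2, THEN conjunct2, THEN conjunct2, THEN conjunct1]
  note m8 = m[THEN conjunct2, THEN conjunct2, THEN conjunct2, THEN conjunct2, THEN conjunct2, THEN conjunct2, THEN conjunct2, THEN conjunct1]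
  note m9 = m[THEN conjunct2, THEN conjunct2, THEN conjunct2, THEN conjunct2, THEN conjunct2, THEN conjunct2, THEN conjunct2, THEN conjunct2, THEN conjunct1]
  note m10 = m[THEN conjunct2, THEN conjunct2, THEN conjunct2, THEN conjunct2, THEN conjunct2, THEN conjunct2, THEN conjunct2, THEN conjunct2, THEN conjunct2, THEN conjunct1]
  note m11 = m[THEN conjunct2, THEN conjunct2, THEN conjunct2, THEN conjunct2, THEN conjunct2, THEN conjunct2, THEN conjunct2, THEN conjunct2, THEN conjunct2, THEN conjunct2, THEN conjunct1]
  note m12 = m[THEN conjunct2, THEN conjunct2, THEN conjunct2, THEN conjunct2, THEN conjunct2, THEN conjunct2, THEN conjunct2, THEN conjunct2, THEN conjunct2, THEN conjunct2, THEN conjunct2]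
  have sub_Union: "\<exists>b\<in>T. a \<subseteq> b" if "a \<in> N" "T \<subseteq> D" "a \<subseteq> \<Union>T" for a T
    using num_Union[of K X a T] that unfolding N_def D_def by blast
  have N_eq: "a = b" if "a \<in> N" "b \<in> N" "a \<subseteq> b" for a b
    using num_subset_num[of D X a b] that unfolding N_def by blast
  have ND: "N \<subseteq> D" by (auto simp: N_def)
  have Un: "\<Union>T \<in> D" if "T \<subseteq> D" for T using Union_upsets that unfolding D_def by blast
  have ind: "P a" if "P (p 6)" "\<And>a b. a \<in> N \<Longrightarrow> b \<in> N \<Longrightarrow> A a (p 7) b \<Longrightarrow> P a \<Longrightarrow> P b" "a \<in> N" for P a
  proof -
    \<comment> \<open>The numbers below \<open>V\<close> are exactly those with property
      \<open>P\<close>, since numbers are join-prime and pairwise incomparable. So the axiom about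
      open sets yields induction for arbitrary predicates.\<close>
    define V where "V = \<Union>{a\<in>N. P a}"
    have V: "V \<in> D" unfolding V_def using ND by (intro Un) blast
    have sub: "a \<subseteq> V \<longleftrightarrow> P a" if "a \<in> N" for a
      using sub_Union[OF that, of "{a\<in>N. P a}"] N_eq[OF that] ND that unfolding V_def by blast
    have "p 6 \<in> N" using m1 p by (simp add: N_def)
    then have "p 6 \<subseteq> V \<and> (\<forall>a\<in>N. \<forall>b\<in>N. A a (p 7) b \<and> a \<subseteq> V \<longrightarrow> b \<subseteq> V)"
      using sub that(1,2) by blast
    then have "\<forall>a\<in>N. a \<subseteq> V" by (rule mp[OF bspec[OF m7 V]])
    then show ?thesis using sub that(3) by blast
  qed
  have "\<exists>f :: nat \<Rightarrow> 'a set set. bij_betw f UNIV N \<and> (\<forall>m n k. A (f m) (f n) (f k) \<longleftrightarrow> k = m + n) \<and>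
      (\<forall>m n k. B (f m) (f n) (f k) \<longleftrightarrow> k = m * n)"
  proof (rule peano_model[of "p 6" N "p 7" A B])
    show "p 6 \<in> N" "p 7 \<in> N" using m1 m2 p by (simp_all add: N_def)
    show "P a" if "P (p 6)" "\<And>a b. a \<in> N \<Longrightarrow> b \<in> N \<Longrightarrow> A a (p 7) b \<Longrightarrow> P a \<Longrightarrow> P b" "a \<in> N" for P a
      using ind[of P a] that by blast
    show "\<exists>b\<in>N. A a (p 7) b" if "a \<in> N" for a using m3 that by blast
    show "b = c" if "a \<in> N" "b \<in> N" "c \<in> N" "A a (p 7) b" "A a (p 7) c" for a b c
      using m4 that by blast
    show "\<not> A a (p 7) (p 6)" if "a \<in> N" for a using m5 that by blast
    show "a = b" if "a \<in> N" "b \<in> N" "c \<in> N" "A a (p 7) c" "A b (p 7) c" for a b c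
      using m6 that by blast
    show "A a (p 6) c \<longleftrightarrow> c = a" if "a \<in> N" "c \<in> N" for a c using m8 that by blast
    show "B a (p 6) c \<longleftrightarrow> c = p 6" if "a \<in> N" "c \<in> N" for a c using m10 that by blast
    show "A a b' c' \<longleftrightarrow> (\<exists>c\<in>N. A a b c \<and> A c (p 7) c')"
      if "a \<in> N" "b \<in> N" "b' \<in> N" "c' \<in> N" "A b (p 7) b'" for a b b' c'
      by (rule mp[OF bspec[OF bspec[OF bspec[OF bspec[OF m9]]]]]) (fact that)+
    show "B a b' c' \<longleftrightarrow> (\<exists>c\<in>N. B a b c \<and> A c a c')"
      if "a \<in> N" "b \<in> N" "b' \<in> N" "c' \<in> N" "A b (p 7) b'" for a b b' c'
      by (rule mp[OF bspec[OF bspec[OF bspec[OF bspec[OF m11]]]]]) (fact that)+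
    show "\<exists>f :: nat \<Rightarrow> 'a set set. bij_betw f UNIV N \<and> (\<forall>m n k. A (f m) (f n) (f k) \<longleftrightarrow> k = m + n) \<and>
        (\<forall>m n k. B (f m) (f n) (f k) \<longleftrightarrow> k = m * n)"
      if "bij_betw f UNIV N" "\<And>m n k. A (f m) (f n) (f k) \<longleftrightarrow> k = m + n"
        "\<And>m n k. B (f m) (f n) (f k) \<longleftrightarrow> k = m * n" for f :: "nat \<Rightarrow> 'a set set"
      by (intro exI[of _ f] conjI allI that)
  qed
  then obtain f :: "nat \<Rightarrow> 'a set set" where f: "bij_betw f UNIV N" and add: "\<And>m n k. A (f m) (f n) (f k) \<longleftrightarrow> k = m + n"
    and mult: "\<And>m n k. B (f m) (f n) (f k) \<longleftrightarrow> k = m * n"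
    by blast
  have fN: "f n \<in> N" for n using f by (auto simp: bij_betw_def)
  have fD: "f n \<in> D" for n using fN ND by blast
  have f_eq: "f m = f n \<longleftrightarrow> m = n" for m n using f by (auto simp: bij_betw_def inj_def)
  have f_sub: "f m \<subseteq> f n \<longleftrightarrow> m = n" for m n using N_eq[OF fN fN, of m n] f_eq by auto
  have f_surj: "\<exists>n. a = f n" if "a \<in> N" for a using f that by (auto simp: bij_betw_def)
  define h where "h U = (if U \<in> N then Inl (THE n. U = f n) else Inr {n. f n \<subseteq> U})" for U
  have h_f: "h (f n) = Inl n" for n using fN[of n] by (simp add: h_def f_eq eq_commute)
  have h_set: "h U = Inr {n. f n \<subseteq> U}" if "U \<notin> N" for U using that by (simp add: h_def)
  have "x \<in> h ` D" for x :: "nat + nat set"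
  proof (cases x)
    case (Inl n)
    then show ?thesis using h_f fD by (metis image_eqI)
  next
    case (Inr T)
    obtain t where t: "t \<in> D" "\<forall>a\<in>N. \<not> a \<subseteq> t \<and> \<not> t \<subseteq> a" using m12 by blast
    \<comment> \<open>No number is below \<open>t\<close>, so by join-primeness only the numbers
      indexed by \<open>T\<close> are below \<open>U\<close>; and \<open>t\<close> is not below any
      number, so \<open>U\<close> is none.\<close>
    define U where "U = \<Union>(insert t (f ` T))"
    have U: "U \<in> D" unfolding U_def using t fD by (intro Un) blast
    have sub: "f n \<subseteq> U \<longleftrightarrow> n \<in> T" for n
    proof
      assume "f n \<subseteq> U"
      then obtain b where "b \<in> insert t (f ` T)" "f n \<subseteq> b"
        using sub_Union[OF fN, of "insert t (f ` T)" n] t fD unfolding U_def by blast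
      moreover have "\<not> f n \<subseteq> t" using t fN by blast
      ultimately obtain j where "j \<in> T" "f n \<subseteq> f j" by blast
      then show "n \<in> T" using f_sub[of n j] by simp
    qed (auto simp: U_def)
    have "U \<notin> N"
    proof
      assume "U \<in> N"
      with t(2) have "\<not> t \<subseteq> U" by blast
      then show False unfolding U_def by blast
    qed
    then have "h U = Inr T" using sub by (simp add: h_set)
    then show ?thesis using U Inr by (metis image_eqI)
  qed
  then have surj: "h ` D = UNIV" by blast
  have isl: "isl (h U) \<longleftrightarrow> U \<in> N" for U by (simp add: h_def)
  have "(N2_interp_eq D e \<longleftrightarrow> h (e 8) = h (e 9)) \<and>
        (\<forall>r l. sig_N2 r = Some l \<longrightarrow> (N2_interp D r e \<longleftrightarrow> N2_rel r (take l [h (e 8), h (e 9), h (e 10)])))"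
    if e: "\<forall>v. e v \<in> D" "\<forall>v<8. e v = p v" for e
  proof -
    have e': "e 0 = X" "e 1 = p 1" "e 2 = p 2" "e 3 = p 3" "e 4 = p 4" "e 5 = p 5"
      using e(2) by (simp_all add: X_def)
    have num: "num D X (e v) \<longleftrightarrow> e v \<in> N" for v using e(1) num_N by blast
    have eq_iff: "h u = h v \<longleftrightarrow> u \<in> N \<and> u = v \<or> u \<notin> N \<and> v \<notin> N \<and> (\<forall>a\<in>N. a \<subseteq> u \<longleftrightarrow> a \<subseteq> v)" for u v
    proof (cases "u \<in> N \<and> v \<in> N")
      case True
      then obtain i j where "u = f i" "v = f j" using f_surj by blast
      then show ?thesis by (auto simp: h_f f_eq fN)
    next
      case False
      show ?thesis
      proof (cases "u \<notin> N \<and> v \<notin> N")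
        case True
        have "(\<forall>a\<in>N. a \<subseteq> u \<longleftrightarrow> a \<subseteq> v) \<longleftrightarrow> (\<forall>n. f n \<subseteq> u \<longleftrightarrow> f n \<subseteq> v)"
          using f_surj fN by blast
        then show ?thesis using True by (auto simp: h_set)
      qed (use False isl[of u] isl[of v] in auto)
    qed
    have mem_iff: "u \<in> N \<and> v \<notin> N \<and> u \<subseteq> v \<longleftrightarrow> (\<exists>n T. h u = Inl n \<and> h v = Inr T \<and> n \<in> T)" for u v
    proof
      assume uv: "u \<in> N \<and> v \<notin> N \<and> u \<subseteq> v"
      then obtain n where "u = f n" using f_surj by blast
      then show "\<exists>n T. h u = Inl n \<and> h v = Inr T \<and> n \<in> T" using uv by (auto simp: h_f h_set)
    next
      assume "\<exists>n T. h u = Inl n \<and> h v = Inr T \<and> n \<in> T"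
      then obtain n T where nT: "h u = Inl n" "h v = Inr T" "n \<in> T" by blast
      then have "u \<in> N" "v \<notin> N" using isl[of u] isl[of v] by simp_all
      then show "u \<in> N \<and> v \<notin> N \<and> u \<subseteq> v" using nT f_surj h_f h_set by fastforce
    qed
    have op_iff: "(u \<in> N \<and> v \<in> N \<and> w \<in> N \<and> C u v w) \<longleftrightarrow>
        (\<exists>a b. h u = Inl a \<and> h v = Inl b \<and> h w = Inl (g a b))"
      if C: "\<And>m n k. C (f m) (f n) (f k) \<longleftrightarrow> k = g m n" for C and g :: "nat \<Rightarrow> nat \<Rightarrow> nat" and u v w
    proof (cases "u \<in> N \<and> v \<in> N \<and> w \<in> N")
      case True
      then obtain i j k where "u = f i" "v = f j" "w = f k" using f_surj by blast
      then show ?thesis by (auto simp: h_f C fN)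
    next
      case False
      then show ?thesis using isl[of u] isl[of v] isl[of w] by auto
    qed
    have "N2_interp_eq D e \<longleftrightarrow> h (e 8) = h (e 9)"
      unfolding N2_interp_eq_def e' num eq_iff ball by blast
    moreover have "N2_interp D r e \<longleftrightarrow> N2_rel r (take l [h (e 8), h (e 9), h (e 10)])"
      if "sig_N2 r = Some l" for r l
      using that
    proof (cases rule: sig_N2_cases)
      case 1
      then show ?thesis by (simp add: N2_interp_def e' num N2_rel_simps isl)
    next
      case 2
      then show ?thesis by (simp add: N2_interp_def e' num N2_rel_simps(2)[simplified] isl)
    next
      case 3
      then show ?thesis by (simp add: N2_interp_def e' num N2_rel_simps mem_iff)
    next
      case 4
      then show ?thesis
        using op_iff[of A "(+)", OF add] by (simp add: N2_interp_def e' e'(2)[simplified] num N2_rel_simps A_def)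
    next
      case 5
      then show ?thesis
        using op_iff[of B "(*)", OF mult] by (simp add: N2_interp_def e' e'(2)[simplified] num N2_rel_simps B_def)
    qed
    ultimately show ?thesis by blast
  qed
  with surj show ?thesis by blast
qed

text \<open>\<open>up K F\<close> and \<open>up K G\<close> intersect in
  \<open>up K (F \<union> G)\<close>, whose generator is in \<open>K\<close>. The version for three
  sets, used to read off a coded relation, works in the same way.\<close>

lemma meet2_le_up:
  assumes "F \<union> G \<in> K" "M \<in> upsets K"
  shows "meet2_le (upsets K) (up K F) (up K G) M \<longleftrightarrow> F \<union> G \<in> M"
proof
  assume le: "meet2_le (upsets K) (up K F) (up K G) M"
  moreover have "up K (F \<union> G) \<subseteq> up K F" "up K (F \<union> G) \<subseteq> up K G" by (auto simp: up_def)
  ultimately have "up K (F \<union> G) \<subseteq> M"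
    using bspec[OF le[unfolded meet2_le_def] up_upsets[of K "F \<union> G"]] by blast
  then show "F \<union> G \<in> M" using up_subset_iff[OF assms] by blast
next
  assume M: "F \<union> G \<in> M"
  show "meet2_le (upsets K) (up K F) (up K G) M"
    unfolding meet2_le_def
  proof (intro ballI impI subsetI)
    fix w E assume "w \<in> upsets K" "w \<subseteq> up K F \<and> w \<subseteq> up K G" "E \<in> w"
    then have "E \<in> K" "F \<union> G \<subseteq> E" unfolding up_def by auto
    then show "E \<in> M" using M assms(2) unfolding upsets_def by blast
  qed
qed

lemma meet3_le_up:
  assumes "F \<union> G \<union> H \<in> K" "M \<in> upsets K"
  shows "meet3_le (upsets K) (up K F) (up K G) (up K H) M \<longleftrightarrow> F \<union> G \<union> H \<in> M"
proof
  assume le: "meet3_le (upsets K) (up K F) (up K G) (up K H) M"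
  moreover have "up K (F \<union> G \<union> H) \<subseteq> up K F" "up K (F \<union> G \<union> H) \<subseteq> up K G" "up K (F \<union> G \<union> H) \<subseteq> up K H"
    by (auto simp: up_def)
  ultimately have "up K (F \<union> G \<union> H) \<subseteq> M"
    using bspec[OF le[unfolded meet3_le_def] up_upsets[of K "F \<union> G \<union> H"]] by blast
  then show "F \<union> G \<union> H \<in> M" using up_subset_iff[OF assms] by blast
next
  assume M: "F \<union> G \<union> H \<in> M"
  show "meet3_le (upsets K) (up K F) (up K G) (up K H) M"
    unfolding meet3_le_def
  proof (intro ballI impI subsetI)
    fix w E assume "w \<in> upsets K" "w \<subseteq> up K F \<and> w \<subseteq> up K G \<and> w \<subseteq> up K H" "E \<in> w"
    then have "E \<in> K" "F \<union> G \<union> H \<subseteq> E" unfolding up_def by auto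
    then show "E \<in> M" using M assms(2) unfolding upsets_def by blast
  qed
qed

text \<open>The atoms \<open>c (j, n)\<close> with \<open>j\<close> = 0, 1, 2 are the three
  families, and all finite sets of atoms are available in \<open>K\<close>. Checking the axioms
  comes down to identities of ordinary addition and multiplication.\<close>

lemma arith_model_exists:
  fixes c :: "nat \<times> nat \<Rightarrow> 'a"
  assumes c: "inj c" and K: "\<And>S. finite S \<Longrightarrow> S \<subseteq> range c \<Longrightarrow> S \<in> K"
  shows "\<exists>p. (\<forall>v. p v \<in> upsets K) \<and>
    arith_model (upsets K) (p 0) (p 1) (p 2) (p 3) (p 4) (p 5) (p 6) (p (7 :: nat))"
proof -
  define D where "D = upsets K"
  define x where "x j n = c (j, n)" for j n
  define g where "g j n = up K {x j n}" for j n
  define ups where "ups \<F> = {G \<in> K. \<exists>F\<in>\<F>. F \<subseteq> G}" for \<F>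
  define X where "X j = ups (range (\<lambda>n. {x j n}))" for j
  define M where "M = ups (range (\<lambda>n. {x 0 n, x 1 n}) \<union> range (\<lambda>n. {x 0 n, x 2 n}))"
  define R where "R f = ups {{x 0 a, x 1 b, x 2 (f a b)} | a b. True}" for f :: "nat \<Rightarrow> nat \<Rightarrow> nat"
  have x_eq: "x i m = x j n \<longleftrightarrow> i = j \<and> m = n" for i j m n
    using c by (auto simp: x_def inj_eq)
  have xK: "{x i m} \<in> K" "{x i m, x j n} \<in> K" "{x i m, x j n, x k l} \<in> K" for i j k l m n
    by (auto intro!: K simp: x_def)
  have upsD: "ups \<F> \<in> D" for \<F> unfolding D_def ups_def upsets_def by blast
  have gD: "g j n \<in> D" for j n unfolding g_def D_def by (rule up_upsets)
  have XD: "X j \<in> D" and MD: "M \<in> D" and RD: "R f \<in> D" for j f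
    unfolding X_def M_def R_def by (rule upsD)+
  have X_iff: "F \<in> X j \<longleftrightarrow> F \<in> K \<and> (\<exists>n. x j n \<in> F)" for F j unfolding X_def ups_def by auto
  have g_mem: "F \<in> g j n \<longleftrightarrow> F \<in> K \<and> x j n \<in> F" for F j n unfolding g_def up_def by auto
  have cji: "cji D U \<longleftrightarrow> (\<exists>F\<in>K. U = up K F)" if "U \<in> D" for U
    using cji_upsets_iff that unfolding D_def by blast
  have cji_g: "cji D (g j n)" for j n using cji[OF gD] xK(1) unfolding g_def by blast
  have g_X: "g j n \<subseteq> X j" for j n by (auto simp: X_iff g_mem)
  have g_eq: "g j m = g j n \<longleftrightarrow> m = n" for j m n
  proof
    assume "g j m = g j n"
    moreover have "{x j m} \<in> g j m" using xK by (simp add: g_mem)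
    ultimately show "m = n" by (auto simp: g_mem x_eq)
  qed simp
  \<comment> \<open>A principal upset below \<open>X j\<close> has a generator containing some
    \<open>x j n\<close>, so it lies inside \<open>g j n\<close>, and maximality forces equality. In
    the other direction, a generator contained in \<open>{x j n}\<close> that contains an atom of
    family \<open>j\<close> is that singleton.\<close>
  have num: "num D (X j) U \<longleftrightarrow> (\<exists>n. U = g j n)" if U: "U \<in> D" for j U
  proof
    assume n: "num D (X j) U"
    then obtain F where F: "F \<in> K" "U = up K F" unfolding num_def using cji[OF U] by blast
    then have "F \<in> X j" using n by (auto simp: num_def up_def)
    then obtain n where "x j n \<in> F" using X_iff by blast
    then have "U \<subseteq> g j n" using F by (auto simp: g_mem up_def)
    then show "\<exists>n. U = g j n" using n gD cji_g g_X unfolding num_def by blast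
  next
    assume "\<exists>n. U = g j n"
    then obtain n where U': "U = g j n" by blast
    have "W = g j n" if W: "W \<in> D" "cji D W" "W \<subseteq> X j" "g j n \<subseteq> W" for W
    proof -
      obtain F where F: "F \<in> K" "W = up K F" using W(1,2) cji by blast
      then have "F \<in> X j" using W(3) by (auto simp: up_def)
      then obtain m where m: "x j m \<in> F" using X_iff by blast
      have "{x j n} \<in> W" using W(4) xK(1) by (auto simp: g_mem)
      then have "F \<subseteq> {x j n}" using F by (simp add: up_def)
      then have "F = {x j n}" using m by (auto dest: subset_singletonD)
      then show ?thesis using F by (simp add: g_def)
    qed
    then show "num D (X j) U" unfolding num_def U' using cji_g g_X by blast
  qed
  have bex: "(\<exists>a\<in>D. num D (X j) a \<and> P a) \<longleftrightarrow> (\<exists>n. P (g j n))" for j P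
    using gD by (auto simp: num cong: conj_cong)
  have ball: "(\<forall>a\<in>D. num D (X j) a \<longrightarrow> P a) \<longleftrightarrow> (\<forall>n. P (g j n))" for j P
    using bex[of j "\<lambda>a. \<not> P a"] by blast
  have meet_M: "meet2_le D (g 0 n) (g i m) M \<longleftrightarrow> m = n" if "i = 1 \<or> i = 2" for n i m
  proof -
    have "meet2_le D (g 0 n) (g i m) M \<longleftrightarrow> {x 0 n, x i m} \<in> M"
      using meet2_le_up[of "{x 0 n}" "{x i m}" K M] xK(2) MD
      unfolding D_def g_def by (simp add: insert_commute)
    also have "\<dots> \<longleftrightarrow> m = n"
      using that xK(2) by (auto simp: M_def ups_def x_eq)
    finally show ?thesis .
  qed
  have meet_R: "meet3_le D (g 0 a) (g 1 b) (g 2 d) (R f) \<longleftrightarrow> d = f a b" for a b d f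
  proof -
    have "meet3_le D (g 0 a) (g 1 b) (g 2 d) (R f) \<longleftrightarrow> {x 0 a, x 1 b, x 2 d} \<in> R f"
      using meet3_le_up[of "{x 0 a}" "{x 1 b}" "{x 2 d}" K "R f"] xK(3) RD
      unfolding D_def g_def by (simp add: insert_commute)
    \<comment> \<open>Each family contributes one atom to the set and one to every generator, so a
      generator included in it has the same three atoms.\<close>
    also have "\<dots> \<longleftrightarrow> d = f a b"
      using xK(3) by (auto simp: R_def ups_def x_eq)
    finally show ?thesis .
  qed
  have rel3: "rel3 D (X 1) (X 2) M (R f) (g 0 a) (g 0 b) (g 0 d) \<longleftrightarrow> d = f a b" for a b d f
  proof -
    have "rel3 D (X 1) (X 2) M (R f) (g 0 a) (g 0 b) (g 0 d) \<longleftrightarrow>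
      (\<exists>y\<in>D. num D (X 1) y \<and> (\<exists>z\<in>D. num D (X 2) z \<and>
       meet2_le D (g 0 b) y M \<and> meet2_le D (g 0 d) z M \<and> meet3_le D (g 0 a) y z (R f)))"
      unfolding rel3_def by blast
    then show ?thesis by (simp add: bex meet_M meet_R del: One_nat_def)
  qed
  have ind: "\<forall>V\<in>D. g 0 0 \<subseteq> V \<and> (\<forall>m n. n = m + 1 \<and> g 0 m \<subseteq> V \<longrightarrow> g 0 n \<subseteq> V) \<longrightarrow> (\<forall>n. g 0 n \<subseteq> V)"
  proof (intro ballI impI allI)
    show "g 0 n \<subseteq> V" if "g 0 0 \<subseteq> V \<and> (\<forall>m n. n = m + 1 \<and> g 0 m \<subseteq> V \<longrightarrow> g 0 n \<subseteq> V)" for V n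
      using that by (induction n) auto
  qed
  have tag: "\<exists>t\<in>D. \<forall>n. \<not> g 0 n \<subseteq> t \<and> \<not> t \<subseteq> g 0 n"
  \<comment> \<open>The second family serves as the tag, as its atoms are unrelated to those of the
    numbers.\<close>
  proof (intro bexI[of _ "X 1"] allI conjI)
    fix n
    have "{x 0 n} \<in> g 0 n" "{x 0 n} \<notin> X 1" using xK(1) by (auto simp: g_mem X_iff x_eq)
    then show "\<not> g 0 n \<subseteq> X 1" by blast
    have "{x 1 n} \<in> X 1" "{x 1 n} \<notin> g 0 n" using xK(1) by (auto simp: g_mem X_iff x_eq)
    then show "\<not> X 1 \<subseteq> g 0 n" by blast
  qed (rule XD)
  have num_g: "num D (X 0) (g 0 n)" for n using num[OF gD] by blast
  have "arith_model D (X 0) (X 1) (X 2) M (R (+)) (R (*)) (g 0 0) (g 0 1)"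
    unfolding arith_model_def bex ball rel3 g_eq
    by (intro conjI num_g ind tag) (simp_all add: add.commute)
  then show ?thesis
    unfolding D_def[symmetric] using XD MD RD gD
    by (intro exI[of _ "\<lambda>v. if v = 0 then X 0 else if v = 1 then X 1 else if v = 2 then X 2
      else if v = 3 then M else if v = 4 then R (+) else if v = 5 then R (*)
      else if v = 6 then g 0 0 else g 0 1"]) simp
qed

lemma N2_reducible_upsets:
  fixes c :: "nat \<times> nat \<Rightarrow> 'a"
  assumes "inj c" "\<And>S. finite S \<Longrightarrow> S \<subseteq> range c \<Longrightarrow> S \<in> K"
  shows "many_one_reducible FO_N2 (FO sig_subset (upsets K) sub_rel)"
  unfolding FO_N2_def
proof (rule many_one_reducible_FO[where E = "N2_interp_eq (upsets K)" and R = "N2_interp (upsets K)"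
      and \<Psi> = "\<lambda>e. arith_model (upsets K) (e 0) (e 1) (e 2) (e 3) (e 4) (e 5) (e 6) (e 7)"])
  show "r < 5 \<and> l \<in> {1, 2, 3}" if "sig_N2 r = Some l" for r l
    using that by (cases rule: sig_N2_cases) auto
  show "sig_subset 5 = None" by (simp add: sig_subset_def)
qed (use arith_model_exists[OF assms] arith_model_interp definable_arith_model
      definable_N2_interp definable_N2_interp_eq in blast)+

section \<open>Upsets of finite sets in second-order arithmetic\<close>

abbreviation "N2_dom \<equiv> UNIV :: (nat + nat set) set"
abbreviation "def_N2 \<equiv> definable sig_N2 N2_dom N2_rel"

text \<open>The domain mixes both sorts. Default values for elements of the wrong sort make these
  maps total and surjective, so a quantifier over numbers or over sets becomes an unrestricted
  quantifier over \<open>N2_dom\<close>.\<close>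

definition num_val :: "nat + nat set \<Rightarrow> nat" where
  "num_val x = (case x of Inl m \<Rightarrow> m | Inr _ \<Rightarrow> 0)"

definition set_val :: "nat + nat set \<Rightarrow> nat set" where
  "set_val x = (case x of Inl _ \<Rightarrow> {} | Inr A \<Rightarrow> A)"

lemma val_simps [simp]: "num_val (Inl m) = m" "set_val (Inr A) = A"
  by (simp_all add: num_val_def set_val_def)

lemma definable_N2_atoms:
  assumes "x < n" "y < n" "z < n"
  shows "def_N2 n (\<lambda>e. isl (e x))"
    and "def_N2 n (\<lambda>e. \<exists>k A. e x = Inl k \<and> e y = Inr A \<and> k \<in> A)"
    and "def_N2 n (\<lambda>e. \<exists>a b. e x = Inl a \<and> e y = Inl b \<and> e z = Inl (a + b))"
    and "def_N2 n (\<lambda>e. \<exists>a b. e x = Inl a \<and> e y = Inl b \<and> e z = Inl (a * b))"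
  using definable_rel[of sig_N2 0 "[x]" n UNIV N2_rel] definable_rel[of sig_N2 2 "[x, y]" n UNIV N2_rel]
    definable_rel[of sig_N2 3 "[x, y, z]" n UNIV N2_rel] definable_rel[of sig_N2 4 "[x, y, z]" n UNIV N2_rel]
    assms
  by (simp_all add: sig_N2_def N2_rel_simps)

text \<open>The signature is relational, so a numerical term is represented by its graph.
  Definability at all levels \<open>m \<ge> n\<close>, with no dependence on variables from
  \<open>n\<close> on, keeps a term usable under further quantifiers.\<close>

definition def_nat :: "nat \<Rightarrow> ((nat \<Rightarrow> nat + nat set) \<Rightarrow> nat) \<Rightarrow> bool" where
  "def_nat n t \<longleftrightarrow> (\<forall>m y. n \<le> m \<longrightarrow> y < m \<longrightarrow> def_N2 m (\<lambda>e. e y = Inl (t e))) \<and>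
     (\<forall>e m b. n \<le> m \<longrightarrow> t (e(m := b)) = t e)"

lemma def_nat_graph: "def_nat n t \<Longrightarrow> n \<le> m \<Longrightarrow> y < m \<Longrightarrow> def_N2 m (\<lambda>e. e y = Inl (t e))"
  and def_nat_local: "def_nat n t \<Longrightarrow> n \<le> m \<Longrightarrow> t (e(m := b)) = t e"
  and def_nat_mono: "def_nat n t \<Longrightarrow> n \<le> m \<Longrightarrow> def_nat m t"
  unfolding def_nat_def by auto

text \<open>Zero is the solution of \<open>x + x = x\<close>; one is the nonzero solution of
  \<open>x * x = x\<close>.\<close>

lemma definable_zero: "x < n \<Longrightarrow> def_N2 n (\<lambda>e. e x = Inl 0)"
  using definable_N2_atoms(3)[of x n x x] by (rule definable_cong) auto

lemma definable_one: "x < n \<Longrightarrow> def_N2 n (\<lambda>e. e x = Inl 1)"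
proof -
  assume x: "x < n"
  have "def_N2 n (\<lambda>e. (\<exists>a b. e x = Inl a \<and> e x = Inl b \<and> e x = Inl (a * b)) \<and> e x \<noteq> Inl 0)"
    by (intro def_intros definable_zero definable_N2_atoms x)
  then show ?thesis by (rule definable_cong) auto
qed

lemma def_nat_var [def_intros]:
  assumes "x < n" shows "def_nat n (\<lambda>e. num_val (e x))"
  unfolding def_nat_def
proof (intro conjI allI impI)
  fix m y assume my: "n \<le> m" "y < m"
  have "def_N2 m (\<lambda>e. isl (e x) \<and> e y = e x \<or> \<not> isl (e x) \<and> e y = Inl 0)"
    using assms my by (intro def_intros definable_zero definable_N2_atoms(1)[of x]) auto
  then show "def_N2 m (\<lambda>e. e y = Inl (num_val (e x)))"
    by (rule definable_cong) (auto simp: num_val_def isl_def split: sum.splits)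
qed (use assms in auto)

lemma def_nat_0 [def_intros]: "def_nat n (\<lambda>e. 0)"
  and def_nat_1 [def_intros]: "def_nat n (\<lambda>e. 1)"
  unfolding def_nat_def using definable_zero definable_one by auto

lemma def_nat_add [def_intros]:
  assumes "def_nat n t" "def_nat n s" shows "def_nat n (\<lambda>e. t e + s e)"
  unfolding def_nat_def
proof (intro conjI allI impI)
  fix m y assume my: "n \<le> m" "y < m"
  have "def_N2 m (\<lambda>e. \<exists>u\<in>N2_dom. \<exists>v\<in>N2_dom. u = Inl (t e) \<and> v = Inl (s e) \<and>
      (\<exists>a b. u = Inl a \<and> v = Inl b \<and> e y = Inl (a + b)))"
    by (intro def_intros definable_N2_atoms def_nat_graph[OF assms(1)] def_nat_graph[OF assms(2)])
      (use my in \<open>simp_all add: def_nat_local[OF assms(1)] def_nat_local[OF assms(2)]\<close>)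
  then show "def_N2 m (\<lambda>e. e y = Inl (t e + s e))" by (rule definable_cong) auto
qed (use def_nat_local assms in metis)

lemma def_nat_mult [def_intros]:
  assumes "def_nat n t" "def_nat n s" shows "def_nat n (\<lambda>e. t e * s e)"
  unfolding def_nat_def
proof (intro conjI allI impI)
  fix m y assume my: "n \<le> m" "y < m"
  have "def_N2 m (\<lambda>e. \<exists>u\<in>N2_dom. \<exists>v\<in>N2_dom. u = Inl (t e) \<and> v = Inl (s e) \<and>
      (\<exists>a b. u = Inl a \<and> v = Inl b \<and> e y = Inl (a * b)))"
    by (intro def_intros definable_N2_atoms def_nat_graph[OF assms(1)] def_nat_graph[OF assms(2)])
      (use my in \<open>simp_all add: def_nat_local[OF assms(1)] def_nat_local[OF assms(2)]\<close>)
  then show "def_N2 m (\<lambda>e. e y = Inl (t e * s e))" by (rule definable_cong) auto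
qed (use def_nat_local assms in metis)

lemma def_nat_const: "def_nat n (\<lambda>e. c)"
proof (induction c)
  case (Suc c)
  then show ?case using def_nat_add[OF Suc def_nat_1] by simp
qed (rule def_nat_0)

lemma definable_nat_eq [def_intros]:
  assumes "def_nat n t" "def_nat n s" shows "def_N2 n (\<lambda>e. t e = s e)"
proof -
  have "def_N2 n (\<lambda>e. \<exists>u\<in>N2_dom. u = Inl (t e) \<and> u = Inl (s e))"
    by (intro def_intros def_nat_graph[OF assms(1)] def_nat_graph[OF assms(2)])
      (simp_all add: def_nat_local[OF assms(1)] def_nat_local[OF assms(2)])
  then show ?thesis by (rule definable_cong) auto
qed

lemma definable_mem [def_intros]:
  assumes "def_nat n t" "x < n" shows "def_N2 n (\<lambda>e. t e \<in> set_val (e x))"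
proof -
  have "def_N2 n (\<lambda>e. \<exists>u\<in>N2_dom. u = Inl (t e) \<and> (\<exists>k A. u = Inl k \<and> e x = Inr A \<and> k \<in> A))"
    by (intro def_intros definable_N2_atoms(2)[where z = x] def_nat_graph[OF assms(1)])
      (use assms(2) in \<open>simp_all add: def_nat_local[OF assms(1)]\<close>)
  then show ?thesis by (rule definable_cong) (auto simp: set_val_def split: sum.splits)
qed

lemma definable_ex_nat [def_intros]:
  fixes P :: "_ \<Rightarrow> nat \<Rightarrow> bool"
  assumes "def_N2 (Suc n) (\<lambda>e. P e (num_val (e n)))" "\<And>e a b. P (e(n := b)) a = P e a"
  shows "def_N2 n (\<lambda>e. \<exists>a. P e a)"
  using definable_ex[of sig_N2 UNIV N2_rel n "\<lambda>e a. P e (num_val a)", OF assms]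
  by (rule definable_cong) (metis UNIV_I val_simps(1))

lemma definable_all_nat [def_intros]:
  fixes P :: "_ \<Rightarrow> nat \<Rightarrow> bool"
  assumes "def_N2 (Suc n) (\<lambda>e. P e (num_val (e n)))" "\<And>e a b. P (e(n := b)) a = P e a"
  shows "def_N2 n (\<lambda>e. \<forall>a. P e a)"
  using definable_all[of sig_N2 UNIV N2_rel n "\<lambda>e a. P e (num_val a)", OF assms]
  by (rule definable_cong) (metis UNIV_I val_simps(1))

lemma definable_all_set [def_intros]:
  fixes P :: "_ \<Rightarrow> nat set \<Rightarrow> bool"
  assumes "def_N2 (Suc n) (\<lambda>e. P e (set_val (e n)))" "\<And>e a b. P (e(n := b)) a = P e a"
  shows "def_N2 n (\<lambda>e. \<forall>a. P e a)"
  using definable_all[of sig_N2 UNIV N2_rel n "\<lambda>e a. P e (set_val a)", OF assms]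
  by (rule definable_cong) (metis UNIV_I val_simps(2))

lemma definable_nat_less [def_intros]:
  assumes "def_nat n t" "def_nat n s" shows "def_N2 n (\<lambda>e. t e < s e)"
proof -
  have "def_N2 n (\<lambda>e. \<exists>c::nat. t e + (c + 1) = s e)"
    by (intro def_intros def_nat_mono[OF assms(1)] def_nat_mono[OF assms(2)])
      (simp_all add: def_nat_local[OF assms(1)] def_nat_local[OF assms(2)])
  then show ?thesis by (rule definable_cong) (simp add: less_iff_Suc_add eq_commute)
qed

section \<open>Pairing, powers of two and binary codes of finite sets in second-order
  arithmetic\<close>

lemma def_natI:
  assumes "\<And>m y. n \<le> m \<Longrightarrow> y < m \<Longrightarrow> def_N2 m (\<lambda>e. t e = num_val (e y))"
    and "\<And>e m b. n \<le> m \<Longrightarrow> t (e(m := b)) = t e"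
  shows "def_nat n t"
  unfolding def_nat_def
proof (intro conjI allI impI)
  fix m y assume my: "n \<le> m" "y < m"
  have "def_N2 m (\<lambda>e. isl (e y) \<and> t e = num_val (e y))"
    using my by (intro def_intros definable_N2_atoms(1)[of y] assms(1))
  then show "def_N2 m (\<lambda>e. e y = Inl (t e))"
    by (rule definable_cong) (auto simp: num_val_def isl_def split: sum.splits)
qed (use assms(2) in blast)

text \<open>Doubling clears the division by two in \<open>triangle\<close> and leaves a polynomial
  equation.\<close>

lemma prod_encode_eq_iff:
  "prod_encode (a, b) = q \<longleftrightarrow> (a + b) * ((a + b) + 1) + (a + a) = q + q"
proof -
  have "triangle n + triangle n = n * (n + 1)" for n by (induction n) auto
  from this[of "a + b"] show ?thesis unfolding prod_encode_def by auto
qed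

lemma def_nat_prod_encode [def_intros]:
  assumes "def_nat n t" "def_nat n s" shows "def_nat n (\<lambda>e. prod_encode (t e, s e))"
proof (rule def_natI)
  show "def_N2 m (\<lambda>e. prod_encode (t e, s e) = num_val (e y))" if "n \<le> m" "y < m" for m y
    unfolding prod_encode_eq_iff
    by (intro def_intros def_nat_mono[OF assms(1)] def_nat_mono[OF assms(2)] that)
  show "prod_encode (t (e(m := b)), s (e(m := b))) = prod_encode (t e, s e)" if "n \<le> m" for e m b
    using that def_nat_local assms by metis
qed

text \<open>The graph of exponentiation is the least set of pairs containing \<open>(0, 1)\<close>
  and closed under doubling. A quantifier over sets expresses leastness directly, in place of coding
  finite sequences.\<close>

lemma power2_eq_iff:
  "2 ^ i = v \<longleftrightarrow> (\<forall>R. prod_encode (0, 1) \<in> R \<and>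
     (\<forall>j w. prod_encode (j, w) \<in> R \<longrightarrow> prod_encode (j + 1, w + w) \<in> R) \<longrightarrow> prod_encode (i, v) \<in> R)"
    (is "_ \<longleftrightarrow> (\<forall>R. ?cl R \<longrightarrow> _)")
proof
  assume v: "2 ^ i = v"
  show "\<forall>R. ?cl R \<longrightarrow> prod_encode (i, v) \<in> R"
  proof (intro allI impI)
    fix R assume R: "?cl R"
    have "prod_encode (i, 2 ^ i) \<in> R"
    proof (induction i)
      case (Suc i)
      have "prod_encode (i + 1, 2 ^ i + 2 ^ i) \<in> R" using R Suc by blast
      then show ?case by (simp add: mult_2)
    qed (use R in simp)
    then show "prod_encode (i, v) \<in> R" using v by simp
  qed
next
  assume *: "\<forall>R. ?cl R \<longrightarrow> prod_encode (i, v) \<in> R"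
  have "?cl {prod_encode (j, 2 ^ j) | j. True}"
    by (auto intro!: exI[of _ "Suc _"])
  with * have "prod_encode (i, v) \<in> {prod_encode (j, 2 ^ j) | j. True}" by blast
  then show "2 ^ i = v" by auto
qed

lemma def_nat_power2 [def_intros]:
  assumes "def_nat n t" shows "def_nat n (\<lambda>e. 2 ^ t e)"
proof (rule def_natI)
  show "def_N2 m (\<lambda>e. 2 ^ t e = num_val (e y))" if "n \<le> m" "y < m" for m y
    unfolding power2_eq_iff
    by (intro def_intros def_nat_mono[OF assms])
      (use that in \<open>simp_all add: def_nat_local[OF assms]\<close>)
  show "2 ^ t (e(m := b)) = (2 :: nat) ^ t e" if "n \<le> m" for e m b
    using that def_nat_local assms by metis
qed

text \<open>Bit \<open>i\<close> of \<open>n\<close> is set iff the quotient by \<open>2 ^ i\<close>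
  is odd; quotient and remainder are supplied by quantifiers.\<close>

lemma mem_set_decode_iff:
  "i \<in> set_decode n \<longleftrightarrow> (\<exists>q r. n = (q + q + 1) * 2 ^ i + r \<and> r < 2 ^ i)"
proof
  assume "i \<in> set_decode n"
  then obtain q where "n div 2 ^ i = q + q + 1"
    unfolding set_decode_def by (auto elim!: oddE simp: mult_2)
  then have "n = (q + q + 1) * 2 ^ i + n mod 2 ^ i" by (metis div_mult_mod_eq)
  then show "\<exists>q r. n = (q + q + 1) * 2 ^ i + r \<and> r < 2 ^ i"
    by (intro exI[of _ q] exI[of _ "n mod 2 ^ i"]) simp
next
  assume "\<exists>q r. n = (q + q + 1) * 2 ^ i + r \<and> r < 2 ^ i"
  then obtain q r where "n = (q + q + 1) * 2 ^ i + r" "r < 2 ^ i" by blast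
  then have "n div 2 ^ i = q + q + 1"
    using div_mult_self1[of "2 ^ i" r "q + q + 1"] by (simp add: add.commute del: div_mult_self1)
  then show "i \<in> set_decode n" by (simp add: set_decode_def)
qed

lemma definable_mem_set_decode [def_intros]:
  assumes "def_nat n t" "def_nat n s" shows "def_N2 n (\<lambda>e. t e \<in> set_decode (s e))"
  unfolding mem_set_decode_iff
  by (intro def_intros def_nat_mono[OF assms(1)] def_nat_mono[OF assms(2)])
    (simp_all add: def_nat_local[OF assms(1)] def_nat_local[OF assms(2)])

text \<open>Codes of sets outside \<open>C\<close> are ignored and numbers count as the empty set of
  codes, so every element of \<open>N2_dom\<close> names an upset. One generated upset is inside
  another iff each generator of the first includes a generator of the second, which
  \<open>le\<close> states arithmetically.\<close>

lemma upsets_reducible_N2: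
  assumes C: "\<And>n x. x < n \<Longrightarrow> def_N2 n (\<lambda>e. set_decode (num_val (e x)) \<in> C)"
  shows "many_one_reducible (FO sig_subset (upsets {F. finite F \<and> F \<in> C}) sub_rel) FO_N2"
proof -
  define K where "K = {F. finite F \<and> F \<in> C}"
  define h where "h x = {F \<in> K. \<exists>n\<in>set_val x. set_decode n \<in> C \<and> set_decode n \<subseteq> F}" for x
  define le where "le u v \<longleftrightarrow> (\<forall>m. m \<in> set_val u \<longrightarrow> set_decode m \<in> C \<longrightarrow>
     (\<exists>n. n \<in> set_val v \<and> set_decode n \<in> C \<and> (\<forall>i. i \<in> set_decode n \<longrightarrow> i \<in> set_decode m)))" for u v
  have def_le: "def_N2 n (\<lambda>e. le (e x) (e y))" if "x < n" "y < n" for n x y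
    unfolding le_def by (intro def_intros C) (use that in simp_all)
  have le: "le u v \<longleftrightarrow> h u \<subseteq> h v" for u v
  proof
    assume le: "le u v"
    show "h u \<subseteq> h v"
    proof
      fix F assume "F \<in> h u"
      then obtain m where m: "F \<in> K" "m \<in> set_val u" "set_decode m \<in> C" "set_decode m \<subseteq> F"
        unfolding h_def by blast
      then obtain n where "n \<in> set_val v" "set_decode n \<in> C" "set_decode n \<subseteq> set_decode m"
        using le unfolding le_def by blast
      then show "F \<in> h v" using m unfolding h_def by blast
    qed
  next
    assume sub: "h u \<subseteq> h v"
    show "le u v" unfolding le_def
    proof (intro allI impI)
      fix m assume m: "m \<in> set_val u" "set_decode m \<in> C"
      then have "set_decode m \<in> h u" unfolding h_def K_def by auto
      then have "set_decode m \<in> h v" using sub by blast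
      then show "\<exists>n. n \<in> set_val v \<and> set_decode n \<in> C \<and> (\<forall>i. i \<in> set_decode n \<longrightarrow> i \<in> set_decode m)"
        unfolding h_def by blast
    qed
  qed
  have "h x \<in> upsets K" for x unfolding h_def upsets_def by blast
  moreover have "U \<in> range h" if U: "U \<in> upsets K" for U
  proof -
    have "F \<in> h (Inr {n. set_decode n \<in> U}) \<longleftrightarrow> F \<in> U" for F
    proof
      assume "F \<in> h (Inr {n. set_decode n \<in> U})"
      then show "F \<in> U" using U unfolding h_def upsets_def by auto
    next
      assume F: "F \<in> U"
      then have FK: "F \<in> K" using U unfolding upsets_def by blast
      then have "set_decode (set_encode F) = F" by (simp add: K_def)
      then show "F \<in> h (Inr {n. set_decode n \<in> U})"
        using F FK unfolding h_def K_def by (auto intro!: exI[of _ "set_encode F"])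
    qed
    then have "U = h (Inr {n. set_decode n \<in> U})" by blast
    then show ?thesis by blast
  qed
  ultimately have h: "range h = upsets K" by blast
  show ?thesis
    unfolding K_def[symmetric] FO_N2_def
  \<comment> \<open>This interpretation has no parameters, hence a trivially true
    \<open>\<Psi>\<close>; equality of upsets is inclusion both ways.\<close>
  proof (rule many_one_reducible_FO[where E = "\<lambda>e. le (e 8) (e 9) \<and> le (e 9) (e 8)"
        and R = "\<lambda>_ e. le (e 8) (e 9)" and \<Psi> = "\<lambda>e. e 0 = e 0"])
    show "r < 5 \<and> l \<in> {1, 2, 3}" if "sig_subset r = Some l" for r l
      using that by (auto simp: sig_subset_def split: if_splits)
    show "sig_N2 5 = None" by (simp add: sig_N2_def)
    show "def_N2 11 (\<lambda>e. le (e 8) (e 9) \<and> le (e 9) (e 8))" "def_N2 11 (\<lambda>e. le (e 8) (e 9))"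
      by (intro def_intros def_le; simp)+
    show "def_N2 8 (\<lambda>e. e 0 = e 0)" by (intro definable_eq) simp_all
    show "\<exists>e. (\<forall>v. e v \<in> (UNIV :: (nat + nat set) set)) \<and> e 0 = (e 0 :: nat + nat set)" by simp
    show "\<exists>h. range h = upsets K \<and> (\<forall>e. (\<forall>v. e v \<in> UNIV) \<longrightarrow> (\<forall>v<8. e v = p v) \<longrightarrow>
        (le (e 8) (e 9) \<and> le (e 9) (e 8) \<longleftrightarrow> h (e 8) = h (e 9)) \<and>
        (\<forall>r l. sig_subset r = Some l \<longrightarrow> (le (e 8) (e 9) \<longleftrightarrow> sub_rel r (take l [h (e 8), h (e 9), h (e 10)]))))"
      for p
      using h by (intro exI[of _ h]) (auto simp: le sig_subset_def sub_rel_def split: if_splits)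
  qed
qed

section \<open>Open sets as upsets\<close>

lemma sat_iso:
  assumes h: "inj_on h D" "h ` D = D'"
    and I: "\<And>r xs. set xs \<subseteq> D \<Longrightarrow> I r xs = I' r (map h xs)"
    and "\<And>v. e v \<in> D"
  shows "sat D I e \<phi> = sat D' I' (h \<circ> e) \<phi>"
  using assms(4)
proof (induction \<phi> arbitrary: e)
  case (Rel r xs)
  then have "set (map e xs) \<subseteq> D" by auto
  then show ?case using I[of "map e xs" r] by (simp add: comp_def)
next
  case (Eq x y)
  then show ?case using h(1) by (simp add: inj_on_eq_iff)
next
  case (Ex x \<phi>)
  have "sat D I (e(x := a)) \<phi> = sat D' I' ((h \<circ> e)(x := h a)) \<phi>" if "a \<in> D" for a
  proof -
    have "sat D I (e(x := a)) \<phi> = sat D' I' (h \<circ> e(x := a)) \<phi>"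
      by (rule Ex.IH) (use that Ex.prems in simp)
    then show ?thesis by (simp add: fun_upd_comp)
  qed
  then show ?case by (simp add: comp_def flip: h(2))
qed auto

lemma FO_iso:
  assumes h: "inj_on h D" "h ` D = D'"
    and I: "\<And>r xs. set xs \<subseteq> D \<Longrightarrow> I r xs = I' r (map h xs)"
  shows "FO sig D I = FO sig D' I'"
proof -
  have "(\<forall>e. (\<forall>v. e v \<in> D) \<longrightarrow> sat D I e \<phi>) \<longleftrightarrow> (\<forall>e. (\<forall>v. e v \<in> D') \<longrightarrow> sat D' I' e \<phi>)" for \<phi>
  proof
    assume *: "\<forall>e. (\<forall>v. e v \<in> D) \<longrightarrow> sat D I e \<phi>"
    show "\<forall>e. (\<forall>v. e v \<in> D') \<longrightarrow> sat D' I' e \<phi>"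
    proof (intro allI impI)
      fix e :: "nat \<Rightarrow> 'b" assume e: "\<forall>v. e v \<in> D'"
      define e' where "e' = inv_into D h \<circ> e"
      have e': "e' v \<in> D" for v using e h(2) by (auto simp: e'_def intro: inv_into_into)
      have "h \<circ> e' = e" using e h(2) by (auto simp: e'_def f_inv_into_f)
      moreover have "sat D I e' \<phi> = sat D' I' (h \<circ> e') \<phi>" by (rule sat_iso[OF h]) (fact I e')+
      moreover have "sat D I e' \<phi>" using * e' by blast
      ultimately show "sat D' I' e \<phi>" by simp
    qed
  next
    assume *: "\<forall>e. (\<forall>v. e v \<in> D') \<longrightarrow> sat D' I' e \<phi>"
    show "\<forall>e. (\<forall>v. e v \<in> D) \<longrightarrow> sat D I e \<phi>"
    proof (intro allI impI)
      fix e :: "nat \<Rightarrow> 'a" assume e: "\<forall>v. e v \<in> D"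
      then have "\<forall>v. (h \<circ> e) v \<in> D'" using h(2) by auto
      then have "sat D' I' (h \<circ> e) \<phi>" using * by blast
      moreover have "sat D I e \<phi> = sat D' I' (h \<circ> e) \<phi>"
        by (rule sat_iso[OF h]) (use I e in blast)+
      ultimately show "sat D I e \<phi>" by simp
    qed
  qed
  then show ?thesis unfolding FO_def by simp
qed

text \<open>\<open>B F\<close> is the least neighbourhood of the point \<open>pt F\<close>, so an
  open set contains \<open>pt F\<close> iff it includes \<open>B F\<close>. By \<open>inter\<close>
  the sets \<open>B F\<close> form a base and not just a subbase; hence an open set is the union of
  the \<open>B F\<close> it includes and is determined by its points \<open>pt F\<close>.\<close>

lemma FO_opens_eq_upsets:
  assumes T: "T = topology_generated_by (B ` K)"
    and pt: "\<And>F G. F \<in> K \<Longrightarrow> G \<in> K \<Longrightarrow> pt F \<in> B G \<longleftrightarrow> G \<subseteq> F"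
    and mono: "\<And>F G. F \<in> K \<Longrightarrow> G \<in> K \<Longrightarrow> G \<subseteq> F \<Longrightarrow> B F \<subseteq> B G"
    and inter: "\<And>F G x. F \<in> K \<Longrightarrow> G \<in> K \<Longrightarrow> x \<in> B F \<Longrightarrow> x \<in> B G \<Longrightarrow> \<exists>H\<in>K. x \<in> B H \<and> B H \<subseteq> B F \<inter> B G"
  shows "FO_opens T = FO sig_subset (upsets K) sub_rel"
proof -
  define h where "h U = {F \<in> K. pt F \<in> U}" for U
  have basic: "\<exists>F\<in>K. x \<in> B F \<and> B F \<subseteq> U" if "openin T U" "x \<in> U" for x U
  proof -
    have "generate_topology_on (B ` K) U"
      using that(1) unfolding T openin_topology_generated_by_iff .
    then show ?thesis using that(2)
    proof (induction arbitrary: x rule: generate_topology_on.induct)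
      case (Int U V)
      obtain F where F: "F \<in> K" "x \<in> B F" "B F \<subseteq> U" using Int by blast
      obtain G where G: "G \<in> K" "x \<in> B G" "B G \<subseteq> V" using Int by blast
      show ?case using inter[OF F(1) G(1) F(2) G(2)] F(3) G(3) by blast
    next
      case (UN \<U>)
      then show ?case by (meson UnionE Union_upper subset_trans)
    qed auto
  qed
  have open_B: "openin T (B F)" if "F \<in> K" for F
    unfolding T using that by (intro topology_generated_by_Basis) simp
  have pt_iff: "pt F \<in> U \<longleftrightarrow> B F \<subseteq> U" if U: "openin T U" and F: "F \<in> K" for U F
  proof
    assume "pt F \<in> U"
    then obtain G where "G \<in> K" "pt F \<in> B G" "B G \<subseteq> U" using basic[OF U] by blast
    then show "B F \<subseteq> U" using pt[OF F] mono[OF F] by blast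
  qed (use pt[OF F F] in blast)
  have sub_iff: "h U \<subseteq> h V \<longleftrightarrow> U \<subseteq> V" if UV: "openin T U" "openin T V" for U V
  proof
    assume sub: "h U \<subseteq> h V"
    show "U \<subseteq> V"
    proof
      fix x assume "x \<in> U"
      then obtain F where F: "F \<in> K" "x \<in> B F" "B F \<subseteq> U" using basic[OF UV(1)] by blast
      then have "F \<in> h V" using sub pt_iff[OF UV(1)] unfolding h_def by blast
      then show "x \<in> V" using F pt_iff[OF UV(2)] unfolding h_def by blast
    qed
  qed (auto simp: h_def)
  have "h U \<in> upsets K" if "openin T U" for U
    using pt_iff[OF that] mono unfolding h_def upsets_def by blast
  moreover have "W \<in> h ` {U. openin T U}" if W: "W \<in> upsets K" for W
  proof -
    have WK: "W \<subseteq> K" using W unfolding upsets_def by blast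
    have "openin T (\<Union>(B ` W))" using open_B WK by (intro openin_Union) blast
    moreover have "h (\<Union>(B ` W)) = W"
    proof (intro equalityI subsetI)
      fix F assume "F \<in> h (\<Union>(B ` W))"
      then obtain G where "G \<in> W" "F \<in> K" "pt F \<in> B G" unfolding h_def by blast
      then have "G \<subseteq> F" using pt WK by blast
      then show "F \<in> W" using W \<open>G \<in> W\<close> \<open>F \<in> K\<close> unfolding upsets_def by blast
    next
      fix F assume "F \<in> W"
      then show "F \<in> h (\<Union>(B ` W))" using WK pt unfolding h_def by blast
    qed
    ultimately show ?thesis by blast
  qed
  ultimately have h: "h ` {U. openin T U} = upsets K" by blast
  have "inj_on h {U. openin T U}" using sub_iff by (intro inj_onI) (metis mem_Collect_eq order_antisym order_refl)
  moreover have "sub_rel r xs = sub_rel r (map h xs)" if "set xs \<subseteq> {U. openin T U}" for r xs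
  proof (cases "length xs = 2")
    case True
    then have "xs ! 0 \<in> set xs" "xs ! 1 \<in> set xs" by simp_all
    then have "h (xs ! 0) \<subseteq> h (xs ! 1) \<longleftrightarrow> xs ! 0 \<subseteq> xs ! 1" using that sub_iff by blast
    then show ?thesis using True by (simp add: sub_rel_def)
  qed (simp add: sub_rel_def)
  ultimately have "FO sig_subset {U. openin T U} sub_rel = FO sig_subset (upsets K) sub_rel"
    using h by (intro FO_iso[of h])
  then show ?thesis unfolding FO_opens_def sub_rel_def[abs_def] .
qed

section \<open>Finite elements of \<open>Pomega\<close> and of the spaces of partial
  functions\<close>

lemma FO_opens_Pomega: "FO_opens Pomega = FO sig_subset (upsets {F :: nat set. finite F \<and> F \<in> UNIV}) sub_rel"
proof (rule FO_opens_eq_upsets[where B = "\<lambda>F. {A :: nat set. F \<subseteq> A}" and pt = "\<lambda>F. F"])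
  show "Pomega = topology_generated_by ((\<lambda>F. {A. F \<subseteq> A}) ` {F :: nat set. finite F \<and> F \<in> UNIV})"
    unfolding Pomega_def by (rule arg_cong[where f = topology_generated_by]) auto
  show "\<exists>H\<in>{F :: nat set. finite F \<and> F \<in> UNIV}. x \<in> {A. H \<subseteq> A} \<and> {A. H \<subseteq> A} \<subseteq> {A. F \<subseteq> A} \<inter> {A. G \<subseteq> A}"
    if "F \<in> {F :: nat set. finite F \<and> F \<in> UNIV}" "G \<in> {F :: nat set. finite F \<and> F \<in> UNIV}" "x \<in> {A. F \<subseteq> A}" "x \<in> {A. G \<subseteq> A}"
    for F G x :: "nat set"
    using that by (intro bexI[of _ "F \<union> G"]) auto
qed auto

text \<open>Coding graphs as sets of numbers turns extension of partial functions into inclusion, so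
  the results on upsets of finite sets of numbers apply to these spaces too.\<close>

definition graph_code :: "(nat \<Rightarrow> nat option) \<Rightarrow> nat set" where
  "graph_code g = {prod_encode (i, v) | i v. g i = Some v}"

definition graph_codes :: "enat \<Rightarrow> nat set set" where
  "graph_codes k = {F. (\<forall>i v w. prod_encode (i, v) \<in> F \<longrightarrow> prod_encode (i, w) \<in> F \<longrightarrow> v = w) \<and>
     (\<forall>i v. prod_encode (i, v) \<in> F \<longrightarrow> enat v < k)}"

lemma prod_encode_graph_code [simp]: "prod_encode (i, v) \<in> graph_code g \<longleftrightarrow> g i = Some v"
  by (auto simp: graph_code_def)

lemma graph_code_in_iff: "graph_code g \<in> graph_codes k \<longleftrightarrow> g \<in> pfun_space k"
  by (auto simp: graph_codes_def pfun_space_def)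

lemma graph_code_subset_iff: "graph_code f \<subseteq> graph_code g \<longleftrightarrow> f \<subseteq>\<^sub>m g"
proof
  assume sub: "graph_code f \<subseteq> graph_code g"
  have "g i = Some v" if "f i = Some v" for i v
    using subsetD[OF sub, of "prod_encode (i, v)"] that by simp
  then show "f \<subseteq>\<^sub>m g" unfolding map_le_def by force
next
  assume "f \<subseteq>\<^sub>m g"
  then show "graph_code f \<subseteq> graph_code g" unfolding map_le_def graph_code_def by force
qed

lemma finite_graph_code_iff: "finite (graph_code f) \<longleftrightarrow> finite (dom f)"
proof -
  have "graph_code f = (\<lambda>i. prod_encode (i, the (f i))) ` dom f"
    by (force simp: graph_code_def)
  moreover have "inj_on (\<lambda>i. prod_encode (i, the (f i))) (dom f)" by (auto intro: inj_onI)
  ultimately show ?thesis using finite_image_iff by metis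
qed

lemma graph_code_surj:
  assumes "F \<in> graph_codes k" obtains f where "f \<in> pfun_space k" "F = graph_code f"
proof -
  define f where "f i = (if \<exists>v. prod_encode (i, v) \<in> F then Some (THE v. prod_encode (i, v) \<in> F) else None)" for i
  have f: "f i = Some v \<longleftrightarrow> prod_encode (i, v) \<in> F" for i v
  proof -
    have "(THE v. prod_encode (i, v) \<in> F) = v" if "prod_encode (i, v) \<in> F" for v
      using assms that by (intro the_equality) (auto simp: graph_codes_def)
    then show ?thesis by (auto simp: f_def)
  qed
  have "n \<in> F \<longleftrightarrow> n \<in> graph_code f" for n
  proof -
    obtain i v where "n = prod_encode (i, v)" by (metis prod_decode_inverse surj_pair)
    then show ?thesis by (simp add: f)
  qed
  then have "F = graph_code f" by blast
  then show thesis using that assms graph_code_in_iff by blast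
qed

lemma graph_codes_subset: "G \<in> graph_codes k \<Longrightarrow> F \<subseteq> G \<Longrightarrow> F \<in> graph_codes k"
  unfolding graph_codes_def by blast

lemma FO_opens_kPartial:
  "FO_opens (kPartial k) = FO sig_subset (upsets {F. finite F \<and> F \<in> graph_codes k}) sub_rel"
proof -
  define B where "B F = {g \<in> pfun_space k. F \<subseteq> graph_code g}" for F
  define K where "K = {F. finite F \<and> F \<in> graph_codes k}"
  have "\<forall>F. \<exists>f. F \<in> graph_codes k \<longrightarrow> f \<in> pfun_space k \<and> F = graph_code f"
    using graph_code_surj by metis
  then obtain pt where pt: "\<And>F. F \<in> graph_codes k \<Longrightarrow> pt F \<in> pfun_space k"
    "\<And>F. F \<in> graph_codes k \<Longrightarrow> graph_code (pt F) = F"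
    by metis
  have "B ` K = {{g \<in> pfun_space k. f \<subseteq>\<^sub>m g} | f. finite (dom f) \<and> f \<in> pfun_space k}" (is "_ = ?R")
  proof (intro equalityI subsetI)
    fix S assume "S \<in> B ` K"
    then obtain F where F: "finite F" "F \<in> graph_codes k" "S = B F" unfolding K_def by blast
    then have "finite (dom (pt F))" using pt(2) by (metis finite_graph_code_iff)
    moreover have "S = {g \<in> pfun_space k. pt F \<subseteq>\<^sub>m g}"
      unfolding F(3) B_def using pt(2)[OF F(2)] by (simp flip: graph_code_subset_iff)
    ultimately show "S \<in> ?R" using pt(1)[OF F(2)] by blast
  next
    fix S assume "S \<in> ?R"
    then obtain f where f: "finite (dom f)" "f \<in> pfun_space k" "S = {g \<in> pfun_space k. f \<subseteq>\<^sub>m g}" by blast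
    then have "S = B (graph_code f)" unfolding B_def graph_code_subset_iff by blast
    then show "S \<in> B ` K" using f unfolding K_def by (auto simp: finite_graph_code_iff graph_code_in_iff)
  qed
  then have T: "kPartial k = topology_generated_by (B ` K)" unfolding kPartial_def by simp
  show ?thesis
    unfolding K_def[symmetric]
  proof (rule FO_opens_eq_upsets[OF T, where pt = pt])
    show "pt F \<in> B G \<longleftrightarrow> G \<subseteq> F" if "F \<in> K" "G \<in> K" for F G
      using that pt unfolding B_def K_def by auto
    show "B F \<subseteq> B G" if "G \<subseteq> F" for F G using that unfolding B_def by blast
    show "\<exists>H\<in>K. x \<in> B H \<and> B H \<subseteq> B F \<inter> B G" if "F \<in> K" "G \<in> K" "x \<in> B F" "x \<in> B G" for F G x
    \<comment> \<open>The union of two graphs need not be a graph; here it is one because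
      \<open>x\<close> extends both.\<close>
    proof (intro bexI[of _ "F \<union> G"] conjI)
      have "graph_code x \<in> graph_codes k" "F \<union> G \<subseteq> graph_code x"
        using that(3,4) unfolding B_def graph_code_in_iff by auto
      then show "F \<union> G \<in> K" using that(1,2) graph_codes_subset unfolding K_def by auto
      show "x \<in> B (F \<union> G)" "B (F \<union> G) \<subseteq> B F \<inter> B G" using that(3,4) unfolding B_def by auto
    qed
  qed
qed

lemma definable_graph_codes:
  assumes "x < n"
  shows "def_N2 n (\<lambda>e. set_decode (num_val (e x)) \<in> graph_codes k)"
proof -
  \<comment> \<open>A finite bound is a numeral of arithmetic; for infinite \<open>k\<close> the
    condition always holds and is expressed by a trivial equation.\<close>
  have k: "def_N2 m (\<lambda>e. enat (num_val (e v)) < k)" if "v < m" for v m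
  proof (cases k)
    case (enat c)
    have "def_N2 m (\<lambda>e. num_val (e v) < c)"
      by (intro def_intros def_nat_const that)
    then show ?thesis by (simp add: enat)
  next
    case infinity
    have "def_N2 m (\<lambda>e. e v = e v)" by (intro def_intros that)
    then show ?thesis by (simp add: infinity)
  qed
  have "def_N2 n (\<lambda>e. (\<forall>i v w. prod_encode (i, v) \<in> set_decode (num_val (e x)) \<longrightarrow>
      prod_encode (i, w) \<in> set_decode (num_val (e x)) \<longrightarrow> v = w) \<and>
     (\<forall>i v. prod_encode (i, v) \<in> set_decode (num_val (e x)) \<longrightarrow> enat v < k))"
    by (intro def_intros k) (use assms in simp_all)
  then show ?thesis by (simp add: graph_codes_def)
qed

theorem theorem3p3:
  shows "FO_opens Pomega \<equiv>\<^sub>m FO_N2 \<and>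
         (\<forall>k::enat. 2 \<le> k \<longrightarrow> FO_opens (kPartial k) \<equiv>\<^sub>m FO_N2)"
proof (intro conjI allI impI)
  have "def_N2 n (\<lambda>e. set_decode (num_val (e x)) \<in> UNIV)" if "x < n" for n x
    using definable_eq[OF that that, of sig_N2 N2_dom N2_rel] by simp
  then have "many_one_reducible (FO sig_subset (upsets {F :: nat set. finite F \<and> F \<in> UNIV}) sub_rel) FO_N2"
    by (rule upsets_reducible_N2)
  moreover have "many_one_reducible FO_N2 (FO sig_subset (upsets {F :: nat set. finite F \<and> F \<in> UNIV}) sub_rel)"
    \<comment> \<open>The pairing function itself supplies the atoms, and every finite set of
      numbers is admissible.\<close>
    by (rule N2_reducible_upsets[OF inj_prod_encode]) simp
  ultimately show "FO_opens Pomega \<equiv>\<^sub>m FO_N2"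
    unfolding many_one_equiv_def FO_opens_Pomega by blast
next
  fix k :: enat assume k: "2 \<le> k"
  \<comment> \<open>The atoms are the one-point functions with value 0, at distinct arguments
    \<open>prod_encode jn\<close>. A common value makes any finitely many of them compatible, and 0
    is below every \<open>k\<close> considered.\<close>
  define c where "c jn = prod_encode (prod_encode jn, 0)" for jn
  have "inj c" by (auto simp: c_def inj_def)
  moreover have "S \<in> {F. finite F \<and> F \<in> graph_codes k}" if "finite S" "S \<subseteq> range c" for S
  proof -
    have "enat 0 < k" using k by (cases k) (auto simp: numeral_eq_enat)
    moreover have "v = 0" if "prod_encode (i, v) \<in> S" for i v
      using that \<open>S \<subseteq> range c\<close> by (auto simp: c_def)
    ultimately show ?thesis using that(1) by (auto simp: graph_codes_def)
  qed
  ultimately have "many_one_reducible FO_N2 (FO sig_subset (upsets {F. finite F \<and> F \<in> graph_codes k}) sub_rel)"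
    by (rule N2_reducible_upsets)
  then show "FO_opens (kPartial k) \<equiv>\<^sub>m FO_N2"
    unfolding many_one_equiv_def FO_opens_kPartial
    using upsets_reducible_N2[OF definable_graph_codes] by simp
qed

end
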